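(* Let $G$ be a Carnot group of homogeneous dimension $Q$ and let $\mathcal N$ be a homogeneous pseudonorm on $G$ such that for some $k\in\mathbb N$ the function $$\psi(q)=\begin{cases}Ce^{-\frac{1}{1-\mathcal N(q)^k}}, & \mathcal N(q)<1,\\ 0,&\mathcal N(q)\ge1,\end{cases}\qquad C^{-1}=\int_G e^{-\frac{1}{1-\mathcal N(q)^k}}\chi_{\{\mathcal N<1\}}\,dq,$$ belongs to $C_0^\infty(G)$. Let $u\in L^1_{loc}(G)$. Then the property $$u(p)=\frac{1}{|B(p,R)|}\int_{B(p,R)}u(q)\,dq\quad\text{for all }p\in G\text{ and all }R>0$$ is equivalent to the property $$u(p)\int_{S(0,1)}d\sigma(v)=\int_{S(0,1)}u(p\,\delta_r(v))\,d\sigma(v)\quad\text{for all }p\in G\text{ and all }r>0,$$ where balls and spheres are those determined by $\mathcal N$. Moreover, either of these properties implies $u\in C^\infty(G)$.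
   Context: $G$ is a Carnot group (stratified nilpotent Lie group identified with its Lie algebra via exp, with dilations $\delta_r$, Lebesgue/Haar measure $dq$), $Q=\sum_i i\dim\mathfrak g_i$. A homogeneous (symmetric) pseudonorm is a continuous $\mathcal N:G\to[0,\infty)$ with $\mathcal N(\delta_rp)=r\mathcal N(p)$, $\mathcal N(p)>0$ iff $p\ne0$, and $\mathcal N(p^{-1})=\mathcal N(p)$. Balls: $B(p,r)=p\,\delta_r(B(0,1))$ with $B(0,1)=\{\mathcal N\le 1\}$; $S(0,1)=\{q:\mathcal N(q)=1\}$. $d\sigma$ is the unique Radon measure on $S(0,1)$ such that $\int_Gu(q)\,dq=\int_0^\infty\int_{S(0,1)}u(\delta_r v)r^{Q-1}\,d\sigma(v)\,dr$ for all integrable $u$. *)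

theory Defs
  imports "HOL-Analysis.Analysis"
begin

fun Ck :: "nat \<Rightarrow> ('a::euclidean_space \<Rightarrow> 'b::real_normed_vector) \<Rightarrow> bool" where
  "Ck 0 f = continuous_on UNIV f"
| "Ck (Suc k) f = ((\<forall>x. f differentiable (at x)) \<and>
                    (\<forall>v. Ck k (\<lambda>x. frechet_derivative f (at x) v)))"

definition smooth :: "('a::euclidean_space \<Rightarrow> 'b::real_normed_vector) \<Rightarrow> bool" where
  "smooth f \<longleftrightarrow> (\<forall>k. Ck k f)"

definition tsupport :: "('a::real_normed_vector \<Rightarrow> 'b::zero) \<Rightarrow> 'a set" where
  "tsupport f = closure {x. f x \<noteq> 0}"

definition smooth_compact_support :: "('a::euclidean_space \<Rightarrow> real) \<Rightarrow> bool" where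
  "smooth_compact_support f \<longleftrightarrow> smooth f \<and> compact (tsupport f)"

text \<open>L^1_loc(G) with respect to Lebesgue (= Haar) measure.\<close>
definition locally_integrable :: "('a::euclidean_space \<Rightarrow> real) \<Rightarrow> bool" where
  "locally_integrable u \<longleftrightarrow> u \<in> borel_measurable lebesgue \<and>
     (\<forall>K. compact K \<longrightarrow> set_integrable lebesgue K u)"

text \<open>The Lie algebra g = V_1 + ... + V_s (direct sum of subspaces) is the
  underlying Euclidean space; graded_decomp V s x j is the V_j-component of x.\<close>
definition graded_decomp :: "(nat \<Rightarrow> 'a::euclidean_space set) \<Rightarrow> nat \<Rightarrow> 'a \<Rightarrow> nat \<Rightarrow> 'a" where
  "graded_decomp V s x = (THE v. (\<forall>j\<in>{1..s}. v j \<in> V j) \<and> (\<forall>j. j \<notin> {1..s} \<longrightarrow> v j = 0)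
                                 \<and> x = (\<Sum>j=1..s. v j))"

definition dil :: "(nat \<Rightarrow> 'a::euclidean_space set) \<Rightarrow> nat \<Rightarrow> real \<Rightarrow> 'a \<Rightarrow> 'a" where
  "dil V s r x = (\<Sum>j=1..s. (r ^ j) *\<^sub>R graded_decomp V s x j)"

definition homdim :: "(nat \<Rightarrow> 'a::euclidean_space set) \<Rightarrow> nat \<Rightarrow> nat" where
  "homdim V s = (\<Sum>j=1..s. j * dim (V j))"

text \<open>Subgroup generated by a set A (closed under products; A below is a
  subspace, hence closed under inverses x^{-1} = -x).\<close>
inductive_set gen_subgroup :: "('a \<Rightarrow> 'a \<Rightarrow> 'a) \<Rightarrow> 'a::zero set \<Rightarrow> 'a set"
  for mul A where
    "0 \<in> gen_subgroup mul A"
  | "a \<in> A \<Longrightarrow> x \<in> gen_subgroup mul A \<Longrightarrow> mul a x \<in> gen_subgroup mul A"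

text \<open>A Carnot group identified with its (stratified) Lie algebra via exp:
  a smooth group law on g with identity 0 and inverse -x, in exponential
  coordinates (lines through 0 are one-parameter subgroups), graded by
  V_1 + ... + V_s so that the dilations are group automorphisms, and
  stratified (the first layer V_1 generates the group, equivalently the Lie
  algebra).\<close>
definition carnot_group :: "('a::euclidean_space \<Rightarrow> 'a \<Rightarrow> 'a) \<Rightarrow> (nat \<Rightarrow> 'a set) \<Rightarrow> nat \<Rightarrow> bool" where
  "carnot_group mul V s \<longleftrightarrow>
     s \<ge> 1 \<and>
     (\<forall>j\<in>{1..s}. subspace (V j)) \<and>
     (\<forall>x. \<exists>!v. (\<forall>j\<in>{1..s}. v j \<in> V j) \<and> (\<forall>j. j \<notin> {1..s} \<longrightarrow> v j = 0)
                \<and> x = (\<Sum>j=1..s. v j)) \<and>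
     (\<forall>x y z. mul (mul x y) z = mul x (mul y z)) \<and>
     (\<forall>x. mul x 0 = x \<and> mul 0 x = x) \<and>
     (\<forall>x. mul x (- x) = 0 \<and> mul (- x) x = 0) \<and>
     smooth (\<lambda>z::'a \<times> 'a. mul (fst z) (snd z)) \<and>
     (\<forall>x a b. mul (a *\<^sub>R x) (b *\<^sub>R x) = (a + b) *\<^sub>R x) \<and>
     (\<forall>r>0. \<forall>x y. dil V s r (mul x y) = mul (dil V s r x) (dil V s r y)) \<and>
     gen_subgroup mul (V 1) = UNIV"

text \<open>Homogeneous symmetric pseudonorm (group inverse of p is -p).\<close>
definition hom_pseudonorm :: "(nat \<Rightarrow> 'a::euclidean_space set) \<Rightarrow> nat \<Rightarrow> ('a \<Rightarrow> real) \<Rightarrow> bool" where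
  "hom_pseudonorm V s N \<longleftrightarrow>
     continuous_on UNIV N \<and> (\<forall>p. N p \<ge> 0) \<and>
     (\<forall>r>0. \<forall>p. N (dil V s r p) = r * N p) \<and>
     (\<forall>p. N p > 0 \<longleftrightarrow> p \<noteq> 0) \<and>
     (\<forall>p. N (- p) = N p)"

definition N_ball :: "('a::euclidean_space \<Rightarrow> 'a \<Rightarrow> 'a) \<Rightarrow> (nat \<Rightarrow> 'a set) \<Rightarrow> nat \<Rightarrow> ('a \<Rightarrow> real)
                      \<Rightarrow> 'a \<Rightarrow> real \<Rightarrow> 'a set" where
  "N_ball mul V s N p r = (\<lambda>q. mul p (dil V s r q)) ` {q. N q \<le> 1}"

definition N_sphere :: "('a \<Rightarrow> real) \<Rightarrow> 'a set" where
  "N_sphere N = {q. N q = 1}"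

definition polar_measure :: "(nat \<Rightarrow> 'a::euclidean_space set) \<Rightarrow> nat \<Rightarrow> ('a \<Rightarrow> real) \<Rightarrow> 'a measure \<Rightarrow> bool" where
  "polar_measure V s N \<sigma> \<longleftrightarrow>
     sets \<sigma> = sets (restrict_space lborel (N_sphere N)) \<and>
     finite_measure \<sigma> \<and>
     (\<forall>f::'a \<Rightarrow> real. integrable lborel f \<longrightarrow>
        integral\<^sup>L lborel f =
          set_lebesgue_integral lborel {0<..}
            (\<lambda>r::real. r ^ (homdim V s - 1) * integral\<^sup>L \<sigma> (\<lambda>v. f (dil V s r v))))"

definition psi :: "('a::euclidean_space \<Rightarrow> real) \<Rightarrow> nat \<Rightarrow> 'a \<Rightarrow> real" where
  "psi N k q =
     (let C = 1 / integral\<^sup>L lebesgue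
                 (\<lambda>q. indicator {q. N q < 1} q * exp (- 1 / (1 - N q ^ k)))
      in if N q < 1 then C * exp (- 1 / (1 - N q ^ k)) else 0)"

end

theory Submission
  imports Defs
begin

text \<open>In polar coordinates the integral of \<open>u\<close> over \<open>B(p, R)\<close> is
  \<open>\<integral>\<^sub>0\<^sup>R r\<^bsup>Q-1\<^esup> F(r) dr\<close>, where \<open>F(r)\<close> is the integral of \<open>u(p \<delta>\<^sub>r v)\<close> over the unit sphere,
  so the spherical property integrates to the ball property. Conversely, the ball property
  makes \<open>u\<close> continuous, because spheres are null sets; then \<open>F\<close> is continuous and the ball
  property can be differentiated in \<open>R\<close>. Since \<open>\<psi>\<close> is a function of \<open>N\<close> with integral one, the
  spherical property gives \<open>u(p) = \<integral> u(q) \<psi>(p\<inverse> q) dq\<close>, which is smooth in \<open>p\<close>.\<close>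

section \<open>Smooth functions\<close>

text \<open>Several obstacles shape the proof. The formula characterising \<open>\<sigma>\<close>
  speaks of Borel functions integrable over the whole space, whereas \<open>u\<close> is only
  Lebesgue measurable and locally integrable, yet is evaluated pointwise. A Borel representative of
  \<open>u\<close> therefore takes its place, and a null set must be shown to meet almost every
  sphere about \<open>p\<close> in a \<open>\<sigma>\<close>-null set. Since this controls almost
  every radius only, the lemma on radial weights asks for the spherical mean only for almost every
  \<open>r\<close>. Recentring at \<open>p\<close> needs left invariance of Lebesgue measure, which
  is not among the axioms of \<open>carnot_group\<close> and is derived from a Jacobian computation.
  All truncations and dominations rest on compactness of the sublevel sets of \<open>N\<close>,
  which homogeneity forces. Smoothness comes after continuity: once \<open>u\<close> is continuous
  it can sit as a fixed factor in an integral over a compact box, and every derivative falls on the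
  kernel.\<close>

lemma frechet_derivative_eq:
  "(f has_derivative f') (at x) \<Longrightarrow> frechet_derivative f (at x) v = f' v"
  using frechet_derivative_at by metis

text \<open>Uniqueness of the derivative lets any explicit formula \<open>f'\<close> replace
  \<open>frechet_derivative\<close>; the closure properties below all enter the recursion of
  \<open>Ck\<close> here.\<close>

lemma Ck_Suc_intro:
  assumes "\<And>x. (f has_derivative f' x) (at x)" and "\<And>v. Ck k (\<lambda>x. f' x v)"
  shows "Ck (Suc k) f"
proof -
  have "frechet_derivative f (at x) v = f' x v" for x v
    using frechet_derivative_eq[OF assms(1)] .
  then show ?thesis
    using assms by (auto simp: differentiable_def)
qed

lemma Ck_Suc_has_derivative:
  "Ck (Suc k) f \<Longrightarrow> (f has_derivative frechet_derivative f (at x)) (at x)"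
  by (simp add: frechet_derivative_works)

lemma Ck_Suc_derivative: "Ck (Suc k) f \<Longrightarrow> Ck k (\<lambda>x. frechet_derivative f (at x) v)"
  by simp

lemma Ck_Suc_imp_Ck: "Ck (Suc k) f \<Longrightarrow> Ck k f"
proof (induction k arbitrary: f)
  case 0
  then show ?case
    by (auto intro!: differentiable_imp_continuous_on simp: differentiable_on_def)
next
  case (Suc k)
  then show ?case
    by (metis Ck.simps(2))
qed

lemma Ck_imp_continuous: "Ck k f \<Longrightarrow> continuous_on UNIV f"
  by (induction k) (auto dest: Ck_Suc_imp_Ck simp del: Ck.simps(2))

lemma Ck_const: "Ck k (\<lambda>x. c)"
  by (induction k arbitrary: c) (auto intro!: Ck_Suc_intro[where f'="\<lambda>x v. 0"] simp del: Ck.simps(2))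

lemma Ck_bounded_linear:
  assumes "bounded_linear f" shows "Ck k f"
proof (cases k)
  case 0
  then show ?thesis
    using assms by (simp add: linear_continuous_on)
next
  case (Suc k')
  then show ?thesis
    using Ck_Suc_intro[where f'="\<lambda>x. f", OF bounded_linear_imp_has_derivative[OF assms] Ck_const]
    by simp
qed

lemma Ck_add: "Ck k f \<Longrightarrow> Ck k g \<Longrightarrow> Ck k (\<lambda>x. f x + g x)"
proof (induction k arbitrary: f g)
  case 0
  then show ?case by (auto intro: continuous_on_add)
next
  case (Suc k)
  show ?case
    by (rule Ck_Suc_intro[OF has_derivative_add[OF Suc.prems[THEN Ck_Suc_has_derivative]]])
      (intro Suc.IH Suc.prems[THEN Ck_Suc_derivative])
qed

lemma Ck_sum: "(\<And>i. i \<in> I \<Longrightarrow> Ck k (f i)) \<Longrightarrow> Ck k (\<lambda>x. \<Sum>i\<in>I. f i x)"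
  by (induction I rule: infinite_finite_induct) (auto intro: Ck_const Ck_add)

lemma (in bounded_bilinear) Ck_bilinear:
  "Ck k f \<Longrightarrow> Ck k g \<Longrightarrow> Ck k (\<lambda>x. prod (f x) (g x))"
proof (induction k arbitrary: f g)
  case 0
  then show ?case by (auto intro: continuous_on)
next
  case (Suc k)
  show ?case
    by (rule Ck_Suc_intro[OF FDERIV[OF Suc.prems[THEN Ck_Suc_has_derivative]]])
      (intro Ck_add Suc.IH Suc.prems[THEN Ck_Suc_derivative] Suc.prems[THEN Ck_Suc_imp_Ck])
qed

lemma linear_Basis_expansion:
  fixes f :: "'a::euclidean_space \<Rightarrow> 'b::real_vector"
  assumes "linear f"
  shows "f x = (\<Sum>b\<in>Basis. (x \<bullet> b) *\<^sub>R f b)"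
proof -
  have "f x = f (\<Sum>b\<in>Basis. (x \<bullet> b) *\<^sub>R b)"
    by (simp add: euclidean_representation)
  then show ?thesis
    using assms by (simp add: linear_sum linear_scale)
qed

text \<open>The chain rule evaluates the derivative of \<open>f\<close> in the direction
  \<open>?g' x v\<close>, which moves with \<open>x\<close>, while \<open>Ck\<close> speaks of fixed
  directions only. Expanding that direction in the basis gives a sum of products of coordinates of
  \<open>?g' x v\<close> with directional derivatives of \<open>f\<close> along fixed
  \<open>b\<close>; the induction hypothesis applies to the latter composed with
  \<open>g\<close>.\<close>

lemma Ck_compose:
  fixes f :: "'b::euclidean_space \<Rightarrow> 'c::real_normed_vector" and g :: "'a::euclidean_space \<Rightarrow> 'b"
  shows "Ck k f \<Longrightarrow> Ck k g \<Longrightarrow> Ck k (\<lambda>x. f (g x))"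
proof (induction k arbitrary: f)
  case 0
  then show ?case by (auto intro: continuous_on_compose2)
next
  case (Suc k)
  let ?f' = "\<lambda>y. frechet_derivative f (at y)" and ?g' = "\<lambda>x. frechet_derivative g (at x)"
  have f': "(f has_derivative ?f' y) (at y)" for y
    using Suc.prems(1) by (rule Ck_Suc_has_derivative)
  have g': "(g has_derivative ?g' x) (at x)" for x
    using Suc.prems(2) by (rule Ck_Suc_has_derivative)
  have "((\<lambda>x. f (g x)) has_derivative (\<lambda>v. \<Sum>b\<in>Basis. (?g' x v \<bullet> b) *\<^sub>R ?f' (g x) b)) (at x)" for x
    using has_derivative_compose[OF g' f', of x]
    by (subst (asm) linear_Basis_expansion[OF has_derivative_linear[OF f']])
  moreover have "Ck k (\<lambda>x. \<Sum>b\<in>Basis. (?g' x v \<bullet> b) *\<^sub>R ?f' (g x) b)" for v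
  proof -
    have "Ck k (\<lambda>x. ?g' x v)" for v
      using Suc.prems(2) by (rule Ck_Suc_derivative)
    moreover have "Ck k (\<lambda>x. ?f' (g x) b)" for b
      using Suc.IH[OF Ck_Suc_derivative Ck_Suc_imp_Ck] Suc.prems by blast
    ultimately show ?thesis
      by (intro Ck_sum bounded_bilinear.Ck_bilinear[OF bounded_bilinear_scaleR]
          bounded_bilinear.Ck_bilinear[OF bounded_bilinear_inner] Ck_const)
  qed
  ultimately show ?case
    by (rule Ck_Suc_intro)
qed

lemma smooth_compose:
  fixes f :: "'b::euclidean_space \<Rightarrow> 'c::real_normed_vector" and g :: "'a::euclidean_space \<Rightarrow> 'b"
  shows "smooth f \<Longrightarrow> smooth g \<Longrightarrow> smooth (\<lambda>x. f (g x))"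
  unfolding smooth_def using Ck_compose by blast

lemma smooth_bounded_linear: "bounded_linear f \<Longrightarrow> smooth f"
  unfolding smooth_def using Ck_bounded_linear by blast

lemma smooth_has_derivative:
  "smooth f \<Longrightarrow> (f has_derivative frechet_derivative f (at x)) (at x)"
  unfolding smooth_def by (metis Ck_Suc_has_derivative)

lemma smooth_derivative: "smooth f \<Longrightarrow> smooth (\<lambda>x. frechet_derivative f (at x) v)"
  unfolding smooth_def by (metis Ck_Suc_derivative)

lemma smooth_imp_continuous: "smooth f \<Longrightarrow> continuous_on UNIV f"
  unfolding smooth_def by (metis Ck_imp_continuous)

section \<open>Differentiation under the integral sign\<close>

lemma has_derivative_partial_fst:
  assumes "(h has_derivative h') (at (p, q))"
  shows "((\<lambda>p. h (p, q)) has_derivative (\<lambda>v. h' (v, 0))) (at p)"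
  by (rule has_derivative_compose[where g=h and f="\<lambda>p. (p, q)"]) (auto intro!: derivative_eq_intros assms)

text \<open>Passes the support condition from a kernel to its derivative in the parameter, so that
  differentiation can be iterated.\<close>

lemma partial_fst_vanishes:
  assumes h: "(h has_derivative h') (at (p, q))" and p: "p \<in> ball a r"
    and zero: "\<And>p. p \<in> ball a r \<Longrightarrow> h (p, q) = 0"
  shows "h' (v, 0) = 0"
proof -
  have "((\<lambda>p. h (p, q)) has_derivative (\<lambda>v. 0)) (at p)"
    by (rule has_derivative_transform_within_open[OF has_derivative_const open_ball p])
      (simp add: zero)
  then show ?thesis
    using has_derivative_unique[OF has_derivative_partial_fst[OF h]] by metis
qed

lemma integral_UNIV_eq_cbox:
  fixes f :: "'a::euclidean_space \<Rightarrow> 'b::banach"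
  assumes "\<And>x. x \<notin> cbox a b \<Longrightarrow> f x = 0"
  shows "integral UNIV f = integral (cbox a b) f"
proof -
  have "(\<lambda>x. if x \<in> cbox a b then f x else 0) = f"
    using assms by auto
  then show ?thesis
    using integral_restrict_UNIV[of "cbox a b" f] by simp
qed

text \<open>For \<open>p\<close> in the ball, the integral over the whole space is one over a fixed
  compact box, where the Leibniz rule needs only joint continuity of the derivative in
  \<open>p\<close>. The factor \<open>u\<close> is never differentiated.\<close>

lemma has_derivative_parametric_integral:
  fixes h :: "'a::euclidean_space \<times> 'b::euclidean_space \<Rightarrow> real" and u :: "'b \<Rightarrow> real"
  assumes h: "smooth h" and u: "continuous_on UNIV u"
    and supp: "\<And>p q. p \<in> ball 0 M \<Longrightarrow> q \<notin> cbox a b \<Longrightarrow> h (p, q) = 0"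
    and p: "p \<in> ball 0 M"
  shows "((\<lambda>p. integral UNIV (\<lambda>q. u q * h (p, q))) has_derivative
          (\<lambda>v. integral UNIV (\<lambda>q. u q * frechet_derivative h (at (p, q)) (v, 0)))) (at p)"
proof -
  let ?U = "ball 0 M :: 'a set"
  let ?D = "\<lambda>p q v. frechet_derivative h (at (p, q)) (v, 0)"
  \<comment> \<open>The Leibniz rule takes the derivative as a value in the space of bounded linear
    maps; in finite dimension its continuity can be tested on fixed vectors.\<close>
  define fx where "fx p q = u q *\<^sub>R Blinfun (?D p q)" for p q
  have hc: "continuous_on UNIV h"
    using h by (rule smooth_imp_continuous)
  have Dc: "continuous_on UNIV (\<lambda>z. frechet_derivative h (at z) w)" for w
    using smooth_imp_continuous[OF smooth_derivative[OF h]] .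
  have der: "((\<lambda>p. h (p, q)) has_derivative ?D p q) (at p)" for p q
    using has_derivative_partial_fst[OF smooth_has_derivative[OF h]] .
  have app: "blinfun_apply (Blinfun (?D p q)) = ?D p q" for p q
    using der[THEN has_derivative_bounded_linear] by (rule bounded_linear_Blinfun_apply)
  have fx_app: "blinfun_apply (fx p q) v = u q * ?D p q v" for p q v
    unfolding fx_def by (simp add: blinfun.scaleR_left app)
  have fx_der: "((\<lambda>p. u q * h (p, q)) has_derivative blinfun_apply (fx p q)) (at p within ?U)" for p q
    unfolding fx_app by (rule has_derivative_at_withinI[OF has_derivative_mult_right[OF der]])
  have hint: "(\<lambda>q. u q * h (p, q)) integrable_on cbox a b" for p
  proof (intro integrable_continuous continuous_on_mult)
    show "continuous_on (cbox a b) u"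
      using u by (rule continuous_on_subset) simp
    show "continuous_on (cbox a b) (\<lambda>q. h (p, q))"
      by (rule continuous_on_compose2[OF hc]) (auto intro!: continuous_intros)
  qed
  have fxc: "continuous_on (?U \<times> cbox a b) (\<lambda>(p, q). fx p q)"
  proof (rule continuous_on_blinfun_componentwise)
    fix v :: 'a
    have "continuous_on (?U \<times> cbox a b) (\<lambda>z. u (snd z))"
      by (rule continuous_on_compose2[OF u continuous_on_snd[OF continuous_on_id]]) simp
    moreover have "continuous_on (?U \<times> cbox a b) (\<lambda>z. frechet_derivative h (at z) (v, 0))"
      using Dc by (rule continuous_on_subset) simp
    ultimately show "continuous_on (?U \<times> cbox a b) (\<lambda>z. blinfun_apply (case z of (p, q) \<Rightarrow> fx p q) v)"
      by (simp add: split_def fx_app continuous_on_mult)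
  qed
  have fxp: "fx p integrable_on cbox a b"
  proof (rule integrable_continuous)
    have "continuous_on (cbox a b) (\<lambda>q. (\<lambda>(p, q). fx p q) (p, q))"
    proof (rule continuous_on_compose2[OF fxc])
      show "continuous_on (cbox a b) (Pair p)"
        by (intro continuous_intros)
    qed (use p in auto)
    then show "continuous_on (cbox a b) (fx p)" by simp
  qed
  have "((\<lambda>p. integral (cbox a b) (\<lambda>q. u q * h (p, q))) has_derivative
      integral (cbox a b) (fx p)) (at p within ?U)"
    by (rule leibniz_rule[OF fx_der hint fxc p]) simp
  then have "((\<lambda>p. integral (cbox a b) (\<lambda>q. u q * h (p, q))) has_derivative
      integral (cbox a b) (fx p)) (at p)"
    by (simp only: at_within_open[OF p open_ball])
  moreover have "integral (cbox a b) (\<lambda>q. u q * h (p, q)) = integral UNIV (\<lambda>q. u q * h (p, q))"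
    if "p \<in> ?U" for p
    by (rule integral_UNIV_eq_cbox[symmetric]) (simp add: supp[OF that])
  ultimately have "((\<lambda>p. integral UNIV (\<lambda>q. u q * h (p, q))) has_derivative
      integral (cbox a b) (fx p)) (at p)"
    using has_derivative_transform_within_open[OF _ open_ball p,
        of "\<lambda>p. integral (cbox a b) (\<lambda>q. u q * h (p, q))" _ UNIV
          "\<lambda>p. integral UNIV (\<lambda>q. u q * h (p, q))"] by blast
  moreover have "?D p q v = 0" if "q \<notin> cbox a b" for q v
    by (rule partial_fst_vanishes[OF smooth_has_derivative[OF h] p supp[OF _ that]])
  then have "blinfun_apply (integral (cbox a b) (fx p)) v = integral UNIV (\<lambda>q. u q * ?D p q v)" for v
    by (simp add: blinfun_apply_integral[OF fxp] fx_app integral_UNIV_eq_cbox[of a b])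
  then have "blinfun_apply (integral (cbox a b) (fx p)) = (\<lambda>v. integral UNIV (\<lambda>q. u q * ?D p q v))"
    by (rule ext)
  ultimately show ?thesis
    by simp
qed

text \<open>Each partial derivative of \<open>h\<close> in the parameter is again a kernel of the
  same kind, so the induction runs over \<open>h\<close>. The box may depend on \<open>M\<close>
  because the support in \<open>q\<close> moves with \<open>p\<close>.\<close>

lemma Ck_parametric_integral:
  fixes h :: "'a::euclidean_space \<times> 'b::euclidean_space \<Rightarrow> real" and u :: "'b \<Rightarrow> real"
  assumes u: "continuous_on UNIV u"
  shows "smooth h \<Longrightarrow> (\<And>M. \<exists>a b. \<forall>p\<in>ball 0 M. \<forall>q. q \<notin> cbox a b \<longrightarrow> h (p, q) = 0) \<Longrightarrow>
    Ck k (\<lambda>p. integral UNIV (\<lambda>q. u q * h (p, q)))"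
proof (induction k arbitrary: h)
  case (Suc k)
  let ?D = "\<lambda>z v. frechet_derivative h (at z) (v, 0)"
  have supp': "\<exists>a b. \<forall>p\<in>ball 0 M. \<forall>q. q \<notin> cbox a b \<longrightarrow> ?D (p, q) v = 0" for v M
  proof -
    obtain a b where ab: "\<forall>p\<in>ball 0 M. \<forall>q. q \<notin> cbox a b \<longrightarrow> h (p, q) = 0"
      using Suc.prems(2) by blast
    have "?D (p, q) v = 0" if "p \<in> ball 0 M" "q \<notin> cbox a b" for p q
      by (rule partial_fst_vanishes[OF smooth_has_derivative[OF Suc.prems(1)] that(1)])
        (simp add: ab that(2))
    then show ?thesis by blast
  qed
  show ?case
  proof (rule Ck_Suc_intro)
    fix p :: 'a
    \<comment> \<open>The radius \<open>norm p + 1\<close> puts \<open>p\<close> inside the open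
      ball.\<close>
    obtain a b where "\<forall>p\<in>ball 0 (norm p + 1). \<forall>q. q \<notin> cbox a b \<longrightarrow> h (p, q) = 0"
      using Suc.prems(2) by blast
    then show "((\<lambda>p. integral UNIV (\<lambda>q. u q * h (p, q))) has_derivative
        (\<lambda>v. integral UNIV (\<lambda>q. u q * ?D (p, q) v))) (at p)"
      by (intro has_derivative_parametric_integral[OF Suc.prems(1) u, of "norm p + 1" a b]) auto
  next
    show "Ck k (\<lambda>p. integral UNIV (\<lambda>q. u q * ?D (p, q) v))" for v
      by (rule Suc.IH[OF smooth_derivative[OF Suc.prems(1)] supp'])
  qed
next
  case 0
  have "continuous_on UNIV (\<lambda>p. integral UNIV (\<lambda>q. u q * h (p, q)))"
  proof (intro continuous_at_imp_continuous_on ballI)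
    fix p :: 'a
    obtain a b where "\<forall>p\<in>ball 0 (norm p + 1). \<forall>q. q \<notin> cbox a b \<longrightarrow> h (p, q) = 0"
      using "0.prems"(2) by blast
    then have "((\<lambda>p. integral UNIV (\<lambda>q. u q * h (p, q))) has_derivative
        (\<lambda>v. integral UNIV (\<lambda>q. u q * frechet_derivative h (at (p, q)) (v, 0)))) (at p)"
      by (intro has_derivative_parametric_integral[OF "0.prems"(1) u, of "norm p + 1" a b]) auto
    then show "isCont (\<lambda>p. integral UNIV (\<lambda>q. u q * h (p, q))) p"
      by (rule has_derivative_continuous)
  qed
  then show ?case by simp
qed

lemma smooth_parametric_integral:
  fixes h :: "'a::euclidean_space \<times> 'b::euclidean_space \<Rightarrow> real" and u :: "'b \<Rightarrow> real"
  assumes "continuous_on UNIV u" "smooth h"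
    and "\<And>M. \<exists>a b. \<forall>p\<in>ball 0 M. \<forall>q. q \<notin> cbox a b \<longrightarrow> h (p, q) = 0"
  shows "smooth (\<lambda>p. integral UNIV (\<lambda>q. u q * h (p, q)))"
  unfolding smooth_def using Ck_parametric_integral[OF assms] by blast

section \<open>Unimodular maps and Lebesgue measure\<close>

text \<open>The change of variables theorem of the library is available only for \<open>real^'n\<close>;
  this type serves as index type for the coordinates of an arbitrary Euclidean space.\<close>

typedef (overloaded) 'a coord_index = "{..<DIM('a::euclidean_space)}"
  by (rule exI[of _ 0]) simp

instantiation coord_index :: (euclidean_space) linorder
begin

definition less_eq_coord_index :: "'a coord_index \<Rightarrow> 'a coord_index \<Rightarrow> bool" where
  "i \<le> j \<longleftrightarrow> Rep_coord_index i \<le> Rep_coord_index j"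

definition less_coord_index :: "'a coord_index \<Rightarrow> 'a coord_index \<Rightarrow> bool" where
  "i < j \<longleftrightarrow> Rep_coord_index i < Rep_coord_index j"

instance
  by standard (auto simp: less_eq_coord_index_def less_coord_index_def Rep_coord_index_inject)

end

instance coord_index :: (euclidean_space) wellorder
proof
  fix P :: "'a coord_index \<Rightarrow> bool" and i
  assume "\<And>i. (\<And>j. j < i \<Longrightarrow> P j) \<Longrightarrow> P i"
  then show "P i"
    unfolding less_coord_index_def by (rule measure_induct_rule[where f=Rep_coord_index])
qed

lemma coord_index_UNIV: "(UNIV :: 'a::euclidean_space coord_index set) = Abs_coord_index ` {..<DIM('a)}"
  using type_definition.Abs_image[OF type_definition_coord_index] by metis

instance coord_index :: (euclidean_space) finite
  by standard (simp add: coord_index_UNIV)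

lemma card_coord_index: "CARD('a::euclidean_space coord_index) = DIM('a)"
  by (subst type_definition.card[OF type_definition_coord_index]) simp

section \<open>Coordinates on a Euclidean space and determinants of its endomorphisms\<close>

definition basis_vec :: "'a::euclidean_space coord_index \<Rightarrow> 'a" where
  "basis_vec = (SOME e. bij_betw e UNIV Basis)"

lemma bij_basis_vec: "bij_betw basis_vec UNIV Basis"
proof -
  have "\<exists>e. bij_betw e (UNIV :: 'a coord_index set) (Basis :: 'a set)"
    by (intro finite_same_card_bij) (auto simp: card_coord_index)
  then show ?thesis
    unfolding basis_vec_def by (rule someI_ex)
qed

lemma basis_vec_in_Basis [simp]: "basis_vec i \<in> Basis"
  using bij_basis_vec by (auto simp: bij_betw_def)

lemma inner_basis_vec: "basis_vec i \<bullet> basis_vec j = (if i = j then 1 else 0)"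
  using bij_basis_vec by (auto simp: inner_Basis bij_betw_def dest: injD)

definition coords :: "'a::euclidean_space \<Rightarrow> real^'a coord_index" where
  "coords x = (\<chi> i. x \<bullet> basis_vec i)"

definition of_coords :: "real^'a coord_index \<Rightarrow> 'a::euclidean_space" where
  "of_coords y = (\<Sum>i\<in>UNIV. y $ i *\<^sub>R basis_vec i)"

lemma linear_coords: "linear coords"
  by (rule linearI) (auto simp: coords_def vec_eq_iff inner_add_left)

lemma linear_of_coords: "linear of_coords"
  by (rule linearI) (auto simp: of_coords_def scaleR_add_left sum.distrib scaleR_sum_right)

lemma coords_of_coords [simp]: "coords (of_coords y) = y"
proof -
  have "(\<Sum>j\<in>UNIV. y $ j * (basis_vec j \<bullet> basis_vec i)) = y $ i" for i
    by (simp add: inner_basis_vec if_distrib cong: if_cong)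
  then show ?thesis
    by (simp add: coords_def of_coords_def vec_eq_iff inner_sum_left)
qed

lemma of_coords_coords [simp]: "of_coords (coords x) = x"
proof -
  have "of_coords (coords x) = (\<Sum>b\<in>Basis. (x \<bullet> b) *\<^sub>R b)"
    unfolding of_coords_def coords_def
    by (simp add: sum.reindex_bij_betw[OF bij_basis_vec, of "\<lambda>b. (x \<bullet> b) *\<^sub>R b"])
  then show ?thesis
    by (simp add: euclidean_representation)
qed

lemma of_coords_inner_basis_vec [simp]: "of_coords y \<bullet> basis_vec i = y $ i"
  by (metis coords_def coords_of_coords vec_lambda_beta)

lemma of_coords_axis [simp]: "of_coords (axis i 1) = basis_vec i"
  by (simp add: of_coords_def axis_def if_distrib[of "\<lambda>c. c *\<^sub>R _"] cong: if_cong)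

lemma continuous_coords: "continuous_on A coords"
  by (rule linear_continuous_on[OF linear_conv_bounded_linear[THEN iffD1, OF linear_coords]])

lemma continuous_of_coords: "continuous_on A of_coords"
  by (rule linear_continuous_on[OF linear_conv_bounded_linear[THEN iffD1, OF linear_of_coords]])

lemma coords_measurable [measurable]: "coords \<in> borel_measurable borel"
  by (rule borel_measurable_continuous_onI[OF continuous_coords])

lemma of_coords_measurable [measurable]: "of_coords \<in> borel_measurable borel"
  by (rule borel_measurable_continuous_onI[OF continuous_of_coords])

lemma coords_vimage_box: "coords -` box l u = box (of_coords l) (of_coords u :: 'a::euclidean_space)"
proof -
  have "(\<forall>b\<in>Basis. P b) \<longleftrightarrow> (\<forall>i. P (basis_vec i))" for P :: "'a \<Rightarrow> bool"
    using bij_betw_imp_surj_on[OF bij_basis_vec] by (metis UNIV_I imageE basis_vec_in_Basis)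
  then show ?thesis
    by (simp add: set_eq_iff coords_def mem_box_cart mem_box)
qed

text \<open>Lebesgue measure is determined by the volumes of boxes, and \<open>coords\<close> merely
  relabels the sides of a box.\<close>

lemma lborel_distr_coords: "distr lborel borel coords = lborel"
proof (rule lborel_eqI[symmetric])
  fix l u :: "real^'a coord_index"
  assume le: "\<And>b. b \<in> Basis \<Longrightarrow> l \<bullet> b \<le> u \<bullet> b"
  have le': "l $ i \<le> u $ i" for i
    using le[of "axis i 1"] by (simp add: inner_axis)
  have "of_coords l \<bullet> b \<le> of_coords u \<bullet> b" if "b \<in> Basis" for b
    using that bij_basis_vec le' of_coords_inner_basis_vec by (metis UNIV_I bij_betw_imp_surj_on imageE)
  then have "emeasure (distr lborel borel coords) (box l u)
    = (\<Prod>b\<in>Basis. (of_coords u - of_coords l) \<bullet> b)"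
    by (simp add: emeasure_distr coords_vimage_box)
  also have "(\<Prod>b\<in>Basis. (of_coords u - of_coords l) \<bullet> b)
      = (\<Prod>i\<in>UNIV. (of_coords u - of_coords l) \<bullet> basis_vec i)"
    by (rule prod.reindex_bij_betw[OF bij_basis_vec, symmetric])
  also have "\<dots> = (\<Prod>i\<in>UNIV. (u - l) $ i)"
    by (simp add: inner_diff_left)
  also have "\<dots> = (\<Prod>b\<in>Basis. (u - l) \<bullet> b)"
  proof -
    have "bij_betw (\<lambda>i::'a coord_index. axis i (1::real)) UNIV Basis"
      by (auto simp: bij_betw_def inj_on_def axis_eq_axis Basis_vec_def)
    then show ?thesis
      using prod.reindex_bij_betw[of _ UNIV Basis "\<lambda>b. (u - l) \<bullet> b"] by (force simp: inner_axis)
  qed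
  finally show "emeasure (distr lborel borel coords) (box l u) = (\<Prod>b\<in>Basis. (u - l) \<bullet> b)" .
qed simp

lemma emeasure_lborel_coords_image:
  assumes "A \<in> sets borel"
  shows "coords ` A \<in> sets borel" "emeasure lborel (coords ` A) = emeasure lborel A"
proof -
  have eq: "coords ` A = of_coords -` A \<inter> space borel"
    by (auto simp: image_iff) (metis coords_of_coords)
  show "coords ` A \<in> sets borel"
    unfolding eq using assms by measurable
  moreover have "coords -` coords ` A = A"
    by (auto simp: image_iff) (metis of_coords_coords)
  ultimately show "emeasure lborel (coords ` A) = emeasure lborel A"
    by (subst lborel_distr_coords[symmetric]) (simp add: emeasure_distr)
qed

text \<open>The determinant of an endomorphism, read off from its matrix in the basis
  \<open>basis_vec\<close>.\<close>

definition edet :: "('a::euclidean_space \<Rightarrow> 'a) \<Rightarrow> real" where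
  "edet T = det (matrix (\<lambda>y. coords (T (of_coords y))))"

lemma edet_id: "edet (\<lambda>x. x) = 1"
  using det_I by (simp add: edet_def matrix_id[unfolded id_def])

lemma edet_compose:
  assumes "linear S" "linear T"
  shows "edet (\<lambda>x. S (T x)) = edet S * edet T"
proof -
  have lin: "linear (\<lambda>y. coords (R (of_coords y)))" if "linear R" for R :: "'a \<Rightarrow> 'a"
    using linear_compose[OF linear_compose[OF linear_of_coords that] linear_coords]
    by (simp add: o_def)
  show ?thesis
    using matrix_compose[OF lin lin, OF assms(2,1)] by (simp add: edet_def o_def det_mul)
qed

text \<open>The determinant is a polynomial in the matrix entries, and each entry is a coordinate of
  the image of one vector, so pointwise convergence suffices.\<close>

lemma tendsto_edet:
  assumes "\<And>b. ((\<lambda>z. T z b) \<longlongrightarrow> T0 b) F"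
  shows "((\<lambda>z. edet (T z)) \<longlongrightarrow> edet T0) F"
  unfolding edet_def det_def matrix_def
  by (auto simp: coords_def intro!: tendsto_intros assms)

text \<open>The preimage of a box under \<open>g\<close> is its image under \<open>f\<close>, and
  continuity of \<open>g\<close> makes it Borel. Transported to coordinates, the change of variables
  formula integrates the constant 1, so the volume of the box is preserved.\<close>

lemma lborel_distr_unimodular:
  fixes f g :: "'a::euclidean_space \<Rightarrow> 'a"
  assumes der: "\<And>x. (f has_derivative f' x) (at x)"
    and det: "\<And>x. \<bar>edet (f' x)\<bar> = 1"
    and gf: "\<And>x. g (f x) = x" and fg: "\<And>x. f (g x) = x"
    and g: "continuous_on UNIV g"
  shows "distr lborel borel g = lborel"
proof (rule lborel_eqI[symmetric])
  have gm: "g \<in> borel_measurable borel"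
    using g by (rule borel_measurable_continuous_onI)
  fix l u :: 'a
  assume le: "\<And>b. b \<in> Basis \<Longrightarrow> l \<bullet> b \<le> u \<bullet> b"
  have vim: "g -` box l u = f ` box l u"
    by (auto simp: gf image_iff) (metis fg)
  have fB: "f ` box l u \<in> sets borel"
    using measurable_sets[OF gm, of "box l u"] by (simp add: vim)
  let ?S = "coords ` box l u" and ?F = "\<lambda>y. coords (f (of_coords y))"
  let ?F' = "\<lambda>y v. coords (f' (of_coords y) (of_coords v))"
  have S: "?S \<in> sets borel" "emeasure lborel ?S = emeasure lborel (box l u)"
    by (rule emeasure_lborel_coords_image, simp)+
  have FS: "?F ` ?S = coords ` (f ` box l u)"
    by (auto simp: image_iff)
  have derF: "(?F has_derivative ?F' y) (at y within ?S)" for y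
  proof -
    have "(of_coords has_derivative of_coords) (at y)"
      by (rule linear_imp_has_derivative[OF linear_of_coords])
    from has_derivative_compose[OF has_derivative_compose[OF this der]
        linear_imp_has_derivative[OF linear_coords]]
    show ?thesis
      by (rule has_derivative_at_withinI)
  qed
  have injF: "inj_on ?F ?S"
    by (rule inj_onI) (metis coords_of_coords of_coords_coords gf)
  have detF: "\<bar>det (matrix (?F' y))\<bar> = 1" for y
    using det[of "of_coords y"] by (simp add: edet_def)
  have SL: "?S \<in> lmeasurable"
    using S emeasure_lborel_box_finite[of l u] by (intro fmeasurableI) (auto simp: less_top)
  have int1: "((\<lambda>y. \<bar>det (matrix (?F' y))\<bar>) has_integral measure lebesgue ?S) ?S"
    unfolding detF lmeasure_integral[OF SL] using SL lmeasurable_iff_integrable_on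
    by (metis integrable_integral)
  have "?F ` ?S \<in> lmeasurable \<and> measure lebesgue (?F ` ?S) = measure lebesgue ?S"
    using has_measure_differentiable_image[OF _ derF injF] int1 S by auto
  then have "emeasure lebesgue (?F ` ?S) = emeasure lebesgue ?S"
    using SL by (simp add: emeasure_eq_measure2 fmeasurableD)
  then have "emeasure lborel (f ` box l u) = emeasure lborel (box l u)"
    unfolding FS using S emeasure_lborel_coords_image[OF fB] by simp
  then show "emeasure (distr lborel borel g) (box l u) = (\<Prod>b\<in>Basis. (u - l) \<bullet> b)"
    using le by (simp add: emeasure_distr gm vim)
qed simp

section \<open>Carnot groups\<close>

locale carnot =
  fixes mul :: "'a::euclidean_space \<Rightarrow> 'a \<Rightarrow> 'a" and V :: "nat \<Rightarrow> 'a set" and s :: nat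
  assumes carnot: "carnot_group mul V s"
begin

abbreviation "proj \<equiv> graded_decomp V s"
abbreviation "\<delta> \<equiv> dil V s"

lemma proj_spec:
  "(\<forall>j\<in>{1..s}. proj x j \<in> V j) \<and> (\<forall>j. j \<notin> {1..s} \<longrightarrow> proj x j = 0) \<and> x = (\<Sum>j=1..s. proj x j)"
proof -
  have "\<exists>!v. (\<forall>j\<in>{1..s}. v j \<in> V j) \<and> (\<forall>j. j \<notin> {1..s} \<longrightarrow> v j = 0) \<and> x = (\<Sum>j=1..s. v j)"
    using carnot by (simp add: carnot_group_def)
  then show ?thesis
    unfolding graded_decomp_def by (rule theI')
qed

lemma proj_unique:
  assumes "\<And>j. j \<in> {1..s} \<Longrightarrow> v j \<in> V j" "\<And>j. j \<notin> {1..s} \<Longrightarrow> v j = 0" "x = (\<Sum>j=1..s. v j)"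
  shows "proj x = v"
proof -
  have "\<exists>!v. (\<forall>j\<in>{1..s}. v j \<in> V j) \<and> (\<forall>j. j \<notin> {1..s} \<longrightarrow> v j = 0) \<and> x = (\<Sum>j=1..s. v j)"
    using carnot by (simp add: carnot_group_def)
  then show ?thesis
    using proj_spec[of x] assms by blast
qed

lemma subspace_layer: "j \<in> {1..s} \<Longrightarrow> subspace (V j)"
  using carnot by (simp add: carnot_group_def)

lemma proj_add: "proj (x + y) = (\<lambda>j. proj x j + proj y j)"
proof (rule proj_unique)
  show "x + y = (\<Sum>j=1..s. proj x j + proj y j)"
    using proj_spec[of x] proj_spec[of y] by (simp add: sum.distrib)
qed (use proj_spec[of x] proj_spec[of y] subspace_layer in \<open>auto intro: subspace_add\<close>)

lemma proj_graded: "proj (\<Sum>j=1..s. c j *\<^sub>R proj x j) = (\<lambda>j. c j *\<^sub>R proj x j)"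
  by (rule proj_unique) (use proj_spec[of x] subspace_layer in \<open>auto intro: subspace_scale\<close>)

lemma proj_scale: "proj (c *\<^sub>R x) = (\<lambda>j. c *\<^sub>R proj x j)"
proof -
  have "c *\<^sub>R x = (\<Sum>j=1..s. c *\<^sub>R proj x j)"
    using proj_spec[of x] by (metis scaleR_sum_right)
  then show ?thesis
    using proj_graded[of "\<lambda>_. c" x] by simp
qed

lemma linear_proj: "linear (\<lambda>x. proj x j)"
  by (rule linearI) (simp_all add: proj_add proj_scale)

lemma linear_dil: "linear (\<delta> r)"
  unfolding dil_def
  by (rule linearI) (simp_all add: proj_add proj_scale scaleR_add_right sum.distrib scaleR_sum_right mult.commute)

lemma dil_dil: "\<delta> r (\<delta> t x) = \<delta> (r * t) x"
proof -
  have "proj (\<delta> t x) = (\<lambda>j. t ^ j *\<^sub>R proj x j)"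
    unfolding dil_def[of V s t x] by (rule proj_graded)
  then show ?thesis
    by (simp add: dil_def[of V s r] dil_def[of V s "r * t"] power_mult_distrib)
qed

lemma dil_1 [simp]: "\<delta> 1 x = x"
  using proj_spec[of x] by (simp add: dil_def)

text \<open>All weights are at least 1, so dilations extend continuously to \<open>r = 0\<close> and
  collapse everything to the origin. The Jacobian limit and the intermediate value argument for
  compactness both start from here.\<close>

lemma dil_0 [simp]: "\<delta> 0 x = 0"
  by (simp add: dil_def power_0_left)

lemma continuous_dil_pair: "continuous_on A (\<lambda>z. \<delta> (fst z) (snd z))"
proof -
  have "continuous_on UNIV (\<lambda>x. proj x j)" for j
    using linear_proj by (intro linear_continuous_on) (simp add: linear_conv_bounded_linear)
  then have "continuous_on A (\<lambda>z. proj (snd z) j)" for j and A :: "(real \<times> 'a) set"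
    by (rule continuous_on_compose2) (auto intro!: continuous_intros)
  then show ?thesis
    unfolding dil_def by (intro continuous_intros)
qed

lemma continuous_dil [continuous_intros]:
  assumes "continuous_on A f" "continuous_on A g"
  shows "continuous_on A (\<lambda>x. \<delta> (f x) (g x))"
  using continuous_on_compose2[OF continuous_dil_pair[of UNIV] continuous_on_Pair[OF assms]] by simp

section \<open>The group law and left invariance of Lebesgue measure\<close>

lemma mul_assoc: "mul (mul x y) z = mul x (mul y z)"
  using carnot by (simp add: carnot_group_def)

lemma mul_0 [simp]: "mul x 0 = x" "mul 0 x = x"
  using carnot by (simp_all add: carnot_group_def)

lemma mul_inverse: "mul x (- x) = 0" "mul (- x) x = 0"
  using carnot by (simp_all add: carnot_group_def)

lemma mul_cancel [simp]: "mul x (mul (- x) y) = y" "mul (- x) (mul x y) = y"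
  by (simp_all add: mul_assoc[symmetric] mul_inverse)

lemma dil_mul: "r > 0 \<Longrightarrow> \<delta> r (mul x y) = mul (\<delta> r x) (\<delta> r y)"
  using carnot by (simp add: carnot_group_def)

lemma smooth_mul: "smooth (\<lambda>z. mul (fst z) (snd z))"
  using carnot by (simp add: carnot_group_def)

lemma continuous_mul [continuous_intros]:
  assumes "continuous_on A f" "continuous_on A g"
  shows "continuous_on A (\<lambda>x. mul (f x) (g x))"
  using continuous_on_compose2[OF smooth_imp_continuous[OF smooth_mul] continuous_on_Pair[OF assms]]
  by simp

lemma mul_measurable [measurable]: "mul p \<in> borel_measurable borel"
  by (intro borel_measurable_continuous_onI continuous_intros)

text \<open>Conjugating by dilations gives \<open>J(p, x) = J(\<delta>\<^sub>r p, \<delta>\<^sub>r x)\<close> for the Jacobian determinant \<open>J\<close>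
  of \<open>x \<mapsto> p x\<close>, and letting \<open>r\<close> tend to zero identifies it with \<open>J(0, 0) = 1\<close>.\<close>

lemma lborel_distr_mul: "distr lborel borel (mul p) = lborel"
proof -
  \<comment> \<open>The derivative of \<open>mul p\<close> is taken as a slice of the total
    derivative of the group law, which makes it jointly continuous in \<open>p\<close> and
    \<open>x\<close>; the limit below moves both.\<close>
  define D where "D p x v = frechet_derivative (\<lambda>z. mul (fst z) (snd z)) (at (p, x)) (0, v)" for p x v
  have der: "(mul p has_derivative D p x) (at x)" for p x
  proof -
    have "((\<lambda>y. (p, y)) has_derivative (\<lambda>v. (0, v))) (at x)"
      by (auto intro!: derivative_eq_intros)
    from has_derivative_compose[OF this smooth_has_derivative[OF smooth_mul]]
    show ?thesis
      by (simp add: D_def[abs_def])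
  qed
  have J_dil: "edet (D (\<delta> r p) (\<delta> r x)) = edet (D p x)" if "r > 0" for r p x
  proof -
    have dil_der: "(\<delta> r has_derivative \<delta> r) (at y)" for y
      by (rule linear_imp_has_derivative[OF linear_dil])
    have "((\<lambda>y. \<delta> r (mul p y)) has_derivative (\<lambda>v. \<delta> r (D p x v))) (at x)"
      by (rule has_derivative_compose[OF der dil_der])
    moreover have "((\<lambda>y. mul (\<delta> r p) (\<delta> r y)) has_derivative (\<lambda>v. D (\<delta> r p) (\<delta> r x) (\<delta> r v))) (at x)"
      by (rule has_derivative_compose[OF dil_der der])
    ultimately have "(\<lambda>v. \<delta> r (D p x v)) = (\<lambda>v. D (\<delta> r p) (\<delta> r x) (\<delta> r v))"
      unfolding dil_mul[OF that] by (rule has_derivative_unique)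
    then have "edet (\<delta> r) * edet (D p x) = edet (D (\<delta> r p) (\<delta> r x)) * edet (\<delta> r)"
      using has_derivative_linear[OF der] linear_dil by (simp flip: edet_compose)
    \<comment> \<open>Invertibility of the dilation makes its determinant nonzero, so it cancels
      from both sides.\<close>
    moreover have "edet (\<delta> r) * edet (\<delta> (1 / r)) = 1"
      using that by (simp add: edet_compose[OF linear_dil linear_dil, symmetric] dil_dil edet_id)
    ultimately show ?thesis
      by auto
  qed
  have J: "edet (D p x) = 1" for p x
  proof -
    have "((\<lambda>r. D (\<delta> r p) (\<delta> r x) b) \<longlongrightarrow> D 0 0 b) (at_right 0)" for b
    proof -
      have "continuous_on UNIV (\<lambda>r. D (\<delta> r p) (\<delta> r x) b)"
        unfolding D_def
        by (rule continuous_on_compose2[OF smooth_imp_continuous[OF smooth_derivative[OF smooth_mul]]])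
          (auto intro!: continuous_intros)
      then have "((\<lambda>r. D (\<delta> r p) (\<delta> r x) b) \<longlongrightarrow> D (\<delta> 0 p) (\<delta> 0 x) b) (at 0)"
        by (simp only: continuous_on_eq_continuous_at[OF open_UNIV] isCont_def UNIV_I ball_UNIV)
      then show ?thesis
        by (simp add: filterlim_at_split)
    qed
    then have "((\<lambda>r. edet (D (\<delta> r p) (\<delta> r x))) \<longlongrightarrow> edet (D 0 0)) (at_right 0)"
      by (rule tendsto_edet)
    moreover have "\<forall>\<^sub>F r in at_right 0. edet (D (\<delta> r p) (\<delta> r x)) = edet (D p x)"
      using eventually_at_right_less[of "0::real"] by eventually_elim (rule J_dil)
    then have "((\<lambda>r. edet (D (\<delta> r p) (\<delta> r x))) \<longlongrightarrow> edet (D p x)) (at_right 0)"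
      by (rule tendsto_eventually)
    ultimately have "edet (D p x) = edet (D 0 0)"
      using tendsto_unique trivial_limit_at_right_real by blast
    also have "D 0 0 = (\<lambda>v. v)"
    proof (rule has_derivative_unique[OF der])
      have "mul 0 = (\<lambda>x. x)"
        by auto
      then show "(mul 0 has_derivative (\<lambda>v. v)) (at 0)"
        by simp
    qed
    finally show ?thesis
      by (simp add: edet_id)
  qed
  \<comment> \<open>The push-forward under \<open>mul p\<close> is governed by the Jacobian of its
    inverse \<open>mul (- p)\<close>.\<close>
  show ?thesis
    by (rule lborel_distr_unimodular[OF der[of "- p"]]) (auto simp: J intro!: continuous_intros)
qed

lemma integral_mul_left:
  fixes f :: "'a \<Rightarrow> real"
  assumes "f \<in> borel_measurable borel"
  shows "(\<integral>q. f (mul p q) \<partial>lborel) = (\<integral>q. f q \<partial>lborel)"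
  using integral_distr[of "mul p" lborel borel f] assms by (simp add: lborel_distr_mul)

lemma integrable_mul_left:
  fixes f :: "'a \<Rightarrow> real"
  assumes "f \<in> borel_measurable borel"
  shows "integrable lborel (\<lambda>q. f (mul p q)) \<longleftrightarrow> integrable lborel f"
  using integrable_distr_eq[of "mul p" lborel borel f] assms by (simp add: lborel_distr_mul)

lemma emeasure_mul_left:
  assumes "A \<in> sets borel"
  shows "emeasure lborel {q. mul p q \<in> A} = emeasure lborel A"
  using emeasure_distr[of "mul p" lborel borel A] assms by (simp add: lborel_distr_mul vimage_def)

end

section \<open>Sublevel sets and balls of the pseudonorm\<close>

locale carnot_pseudonorm = carnot +
  fixes N :: "'a \<Rightarrow> real"
  assumes pseudonorm: "hom_pseudonorm V s N"
begin

lemma N_nonneg: "N p \<ge> 0"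
  and N_dil: "r > 0 \<Longrightarrow> N (\<delta> r p) = r * N p"
  and N_pos_iff: "N p > 0 \<longleftrightarrow> p \<noteq> 0"
  and continuous_N_UNIV: "continuous_on UNIV N"
  using pseudonorm by (auto simp: hom_pseudonorm_def)

lemma continuous_N [continuous_intros]: "continuous_on A f \<Longrightarrow> continuous_on A (\<lambda>x. N (f x))"
  using continuous_on_compose2[OF continuous_N_UNIV] by simp

lemma N_measurable [measurable]: "N \<in> borel_measurable borel"
  using continuous_N_UNIV by (rule borel_measurable_continuous_onI)

lemma N_0 [simp]: "N 0 = 0"
  using N_pos_iff[of 0] N_nonneg[of 0] by simp

text \<open>On the Euclidean unit sphere \<open>N\<close> has a positive minimum \<open>c\<close>. A
  point \<open>q\<close> outside the unit ball shrinks onto that sphere under some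
  \<open>\<delta> t\<close>, and homogeneity turns \<open>c \<le> N (\<delta> t q)\<close> into
  \<open>1 / t \<le> R / c\<close>. Thus \<open>q\<close> lies in the compact image \<open>K\<close>
  of bounded dilations of the sphere.\<close>

lemma compact_N_le: "compact {q. N q \<le> R}"
proof -
  have "sphere 0 1 \<noteq> ({} :: 'a set)"
    by simp
  then obtain y0 :: 'a where y0: "norm y0 = 1" and min: "\<And>y. norm y = 1 \<Longrightarrow> N y0 \<le> N y"
    using continuous_attains_inf[of "sphere 0 1" N] continuous_on_subset[OF continuous_N_UNIV]
    by (auto simp: dist_norm)
  define c where "c = N y0"
  have c: "c > 0"
    using y0 by (auto simp: c_def N_pos_iff)
  define K where "K = (\<lambda>z. \<delta> (fst z) (snd z)) ` ({0..R / c} \<times> sphere 0 1)"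
  have "bounded K"
    unfolding K_def
    by (intro compact_imp_bounded compact_continuous_image continuous_intros compact_Times
        compact_Icc compact_sphere continuous_on_fst continuous_on_snd continuous_on_id)
  have "q \<in> cball 0 1 \<union> K" if q: "N q \<le> R" for q
  proof (cases "norm q \<le> 1")
    case False
    \<comment> \<open>The Euclidean norm does not scale simply under \<open>\<delta>\<close>, so
      \<open>t\<close> comes from the intermediate value theorem on \<open>[0, 1]\<close> instead of
      a division.\<close>
    have "\<exists>t\<ge>0. t \<le> 1 \<and> norm (\<delta> t q) = 1"
      by (rule IVT') (use False in \<open>auto intro!: continuous_intros\<close>)
    then obtain t where t: "t \<ge> 0" "t \<le> 1" "norm (\<delta> t q) = 1"
      by blast
    then have "t > 0"
      by (cases "t = 0") auto
    have "c \<le> t * N q"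
      using min[OF t(3)] N_dil[OF \<open>t > 0\<close>] by (simp add: c_def)
    also have "\<dots> \<le> t * R"
      using q t by (intro mult_left_mono) auto
    finally have "1 / t \<in> {0..R / c}"
      using c \<open>t > 0\<close> by (simp add: field_simps)
    moreover have "q = \<delta> (1 / t) (\<delta> t q)"
      using \<open>t > 0\<close> by (simp add: dil_dil)
    ultimately have "q \<in> K"
      unfolding K_def using t(3) by (intro image_eqI[where x="(1 / t, \<delta> t q)"]) auto
    then show ?thesis
      by simp
  qed simp
  then have "{q. N q \<le> R} \<subseteq> cball 0 1 \<union> K"
    by blast
  moreover have "bounded (cball 0 1 \<union> K)"
    using \<open>bounded K\<close> by simp
  ultimately have "bounded {q. N q \<le> R}"
    by (metis bounded_subset)
  moreover have "closed {q. N q \<le> R}"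
    by (intro closed_Collect_le continuous_intros)
  ultimately show ?thesis
    by (simp add: compact_eq_bounded_closed)
qed

lemma emeasure_N_less_nonzero: "R > 0 \<Longrightarrow> emeasure lborel {q. N q < R} \<noteq> 0"
proof
  assume R: "R > 0" and null: "emeasure lborel {q. N q < R} = 0"
  have "open {q. N q < R}"
    by (intro open_Collect_less continuous_intros)
  moreover have "{q. N q < R} \<in> null_sets lebesgue"
    using null by (intro null_sets_completionI null_setsI) auto
  ultimately have "{q. N q < R} = {}"
    using negligible_iff_null_sets open_not_negligible by blast
  moreover have "0 \<in> {q. N q < R}"
    using R by simp
  ultimately show False
    by simp
qed

abbreviation "nball p R \<equiv> N_ball mul V s N p R"

text \<open>Membership becomes an inequality for \<open>N (mul (- p) q)\<close>, which is continuous
  in \<open>p\<close> and becomes radial after translation by \<open>p\<close>.\<close>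

lemma nball_eq: "R > 0 \<Longrightarrow> nball p R = {q. N (mul (- p) q) \<le> R}"
proof (intro set_eqI iffI)
  assume R: "R > 0"
  fix q
  show "q \<in> {q. N (mul (- p) q) \<le> R}" if "q \<in> nball p R"
    using that R by (auto simp: N_ball_def N_dil)
  assume "q \<in> {q. N (mul (- p) q) \<le> R}"
  then have "N (\<delta> (1 / R) (mul (- p) q)) \<le> 1"
    using R by (simp add: N_dil)
  moreover have "mul p (\<delta> R (\<delta> (1 / R) (mul (- p) q))) = q"
    using R by (simp add: dil_dil)
  ultimately show "q \<in> nball p R"
    unfolding N_ball_def by (intro image_eqI) auto
qed

text \<open>For \<open>R > 0\<close> this is the union of the balls of radius \<open>R\<close>
  centred in \<open>P\<close>: one compact set serving all these centres, used both for domination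
  and for the support of the kernel.\<close>

lemma compact_mul_N_le: "compact P \<Longrightarrow> compact ((\<lambda>z. mul (fst z) (snd z)) ` (P \<times> {q. N q \<le> R}))"
  by (intro compact_continuous_image compact_Times compact_N_le continuous_intros
      continuous_on_fst continuous_on_snd continuous_on_id)

lemma mem_mul_N_le:
  "p \<in> P \<Longrightarrow> N (mul (- p) q) \<le> R \<Longrightarrow> q \<in> (\<lambda>z. mul (fst z) (snd z)) ` (P \<times> {q. N q \<le> R})"
  by (intro image_eqI[where x="(p, mul (- p) q)"]) auto

lemma compact_nball: "R > 0 \<Longrightarrow> compact (nball p R)"
proof -
  assume "R > 0"
  then have "nball p R = (\<lambda>z. mul (fst z) (snd z)) ` ({p} \<times> {q. N q \<le> R})"
    using mem_mul_N_le[of p "{p}"] by (auto simp: nball_eq)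
  then show ?thesis
    using compact_mul_N_le[of "{p}" R] by simp
qed

lemma measure_nball:
  assumes "R > 0"
  shows "measure lebesgue (nball p R) = measure lborel {q. N q \<le> R}"
    and "measure lborel {q. N q \<le> R} > 0"
proof -
  have "measure lebesgue (nball p R) = measure lborel {q. N (mul (- p) q) \<le> R}"
    using assms by (simp add: nball_eq)
  also have "\<dots> = measure lborel {q. N q \<le> R}"
    using emeasure_mul_left[of "{q. N q \<le> R}" "- p"] by (simp add: measure_def)
  finally show "measure lebesgue (nball p R) = measure lborel {q. N q \<le> R}" .
  have "emeasure lborel {q. N q < R} \<le> emeasure lborel {q. N q \<le> R}"
    by (intro emeasure_mono) auto
  moreover have "emeasure lborel {q. N q \<le> R} < \<infinity>"
    using compact_N_le by (intro emeasure_compact_finite)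
  ultimately show "measure lborel {q. N q \<le> R} > 0"
    using emeasure_N_less_nonzero[OF assms] by (auto simp: measure_def enn2real_positive_iff zero_less_iff_neq_zero)
qed

end

section \<open>Polar coordinates\<close>

text \<open>By the fundamental theorem the primitive has derivative \<open>f r\<close> at
  \<open>r\<close>, but it vanishes near \<open>r\<close>.\<close>

lemma integral_continuous_prefix_zero:
  fixes f :: "real \<Rightarrow> real"
  assumes f: "continuous_on UNIV f" and "\<And>R. R > 0 \<Longrightarrow> integral {0..R} f = 0" and "r > 0"
  shows "f r = 0"
proof -
  have r: "r \<in> {0<..<r + 1}"
    using \<open>r > 0\<close> by simp
  have "((\<lambda>x. integral {0..x} f) has_real_derivative f r) (at r within {0..r + 1})"
    using r by (intro integral_has_real_derivative continuous_on_subset[OF f]) auto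
  then have "((\<lambda>x. integral {0..x} f) has_real_derivative f r) (at r)"
    using r at_within_Icc_at[of 0 r "r + 1"] by simp
  moreover have "((\<lambda>x. integral {0..x} f) has_real_derivative 0) (at r)"
    by (rule has_field_derivative_transform_within_open[of "\<lambda>_. 0" _ _ "{0<..<r + 1}"])
      (use r assms(2) in auto)
  ultimately show ?thesis
    by (rule DERIV_unique)
qed

text \<open>Converts the truncated radial integral produced by polar coordinates into the gauge
  integral of the fundamental theorem; the domains differ at most by the point 0.\<close>

lemma set_integral_Ioc_eq_integral_Icc:
  fixes f :: "real \<Rightarrow> real"
  assumes f: "continuous_on UNIV f"
  shows "set_lebesgue_integral lborel {0<..} (\<lambda>r. indicator {..R} r * f r) = integral {0..R} f"
proof -
  have [measurable]: "f \<in> borel_measurable borel"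
    using f by (rule borel_measurable_continuous_onI)
  have "set_integrable lborel {0..R} f"
    unfolding set_integrable_def
    by (intro borel_integrable_compact continuous_on_subset[OF f]) auto
  then have "integral {0..R} f = set_lebesgue_integral lborel {0..R} f"
    using set_borel_integral_eq_integral by metis
  also have "\<dots> = set_lebesgue_integral lborel {0<..R} f"
    unfolding set_lebesgue_integral_def
    by (rule integral_cong_AE, measurable)
      (use AE_lborel_singleton[of 0] in eventually_elim, auto simp: indicator_def)
  also have "\<dots> = set_lebesgue_integral lborel {0<..} (\<lambda>r. indicator {..R} r * f r)"
    unfolding set_lebesgue_integral_def by (intro Bochner_Integration.integral_cong) (auto simp: indicator_def)
  finally show ?thesis ..
qed

locale carnot_polar = carnot_pseudonorm +
  fixes \<sigma> :: "'a measure"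
  assumes polar: "polar_measure V s N \<sigma>"
begin

abbreviation "m \<equiv> homdim V s - 1"

lemma sets_sigma: "sets \<sigma> = sets (restrict_space borel (N_sphere N))"
  using polar by (simp add: polar_measure_def cong: sets_restrict_space_cong)

lemma space_sigma: "space \<sigma> = N_sphere N"
  using sets_eq_imp_space_eq[OF sets_sigma] by (simp add: space_restrict_space)

lemma N_space_sigma: "v \<in> space \<sigma> \<Longrightarrow> N v = 1"
  by (simp add: space_sigma N_sphere_def)

sublocale sigma: finite_measure \<sigma>
  using polar by (simp add: polar_measure_def)

lemma borel_imp_measurable_sigma:
  assumes "f \<in> borel_measurable borel" shows "f \<in> borel_measurable \<sigma>"
  using measurable_restrict_space1[OF assms] sets_sigma by (simp cong: measurable_cong_sets)

lemma dil_measurable_pair [measurable]: "(\<lambda>z. \<delta> (fst z) (snd z)) \<in> borel_measurable (borel \<Otimes>\<^sub>M \<sigma>)"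
proof -
  have "(\<lambda>z. (fst z, snd z)) \<in> borel \<Otimes>\<^sub>M \<sigma> \<rightarrow>\<^sub>M borel \<Otimes>\<^sub>M (borel :: 'a measure)"
    by (intro measurable_Pair measurable_fst
        measurable_compose[OF measurable_snd borel_imp_measurable_sigma]) (simp add: measurable_ident)
  moreover have "(\<lambda>z. \<delta> (fst z) (snd z)) \<in> borel_measurable (borel \<Otimes>\<^sub>M (borel :: 'a measure))"
    unfolding borel_prod by (intro borel_measurable_continuous_onI continuous_dil_pair)
  ultimately show ?thesis
    by (auto dest: measurable_compose)
qed

lemma dil_measurable [measurable]: "\<delta> r \<in> borel_measurable \<sigma>"
  by (intro borel_imp_measurable_sigma borel_measurable_continuous_onI continuous_intros)

lemma sigma_integral_measurable:
  fixes h :: "'a \<Rightarrow> real"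
  assumes [measurable]: "h \<in> borel_measurable borel"
  shows "(\<lambda>r. \<integral>v. h (\<delta> r v) \<partial>\<sigma>) \<in> borel_measurable borel"
proof -
  have "(\<lambda>z. h (\<delta> (fst z) (snd z))) \<in> borel_measurable (borel \<Otimes>\<^sub>M \<sigma>)"
    by measurable
  then show ?thesis
    by (intro sigma.borel_measurable_lebesgue_integral) (simp add: split_def)
qed

text \<open>Since \<open>N (\<delta> r v) = r\<close> on the unit sphere, the factor depending on
  \<open>N\<close> leaves the inner integral.\<close>

lemma integral_polar:
  fixes g :: "real \<Rightarrow> real"
  assumes "integrable lborel (\<lambda>q. g (N q) * h q)"
  shows "(\<integral>q. g (N q) * h q \<partial>lborel)
    = set_lebesgue_integral lborel {0<..} (\<lambda>r. g r * (r ^ m * (\<integral>v. h (\<delta> r v) \<partial>\<sigma>)))"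
proof -
  have "(\<integral>q. g (N q) * h q \<partial>lborel)
    = set_lebesgue_integral lborel {0<..} (\<lambda>r. r ^ m * (\<integral>v. g (N (\<delta> r v)) * h (\<delta> r v) \<partial>\<sigma>))"
    using assms polar by (simp add: polar_measure_def)
  also have "\<dots> = set_lebesgue_integral lborel {0<..} (\<lambda>r. g r * (r ^ m * (\<integral>v. h (\<delta> r v) \<partial>\<sigma>)))"
  proof (rule set_lebesgue_integral_cong)
    have "(\<integral>v. g (N (\<delta> r v)) * h (\<delta> r v) \<partial>\<sigma>) = (\<integral>v. g r * h (\<delta> r v) \<partial>\<sigma>)" if "r > 0" for r
      using that by (intro Bochner_Integration.integral_cong) (auto simp: N_dil N_space_sigma)
    then show "\<forall>r. r \<in> {0<..} \<longrightarrow> r ^ m * (\<integral>v. g (N (\<delta> r v)) * h (\<delta> r v) \<partial>\<sigma>)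
        = g r * (r ^ m * (\<integral>v. h (\<delta> r v) \<partial>\<sigma>))"
      by simp
  qed simp
  finally show ?thesis .
qed

text \<open>Polar coordinates are applied forwards to \<open>h\<close> and backwards to the constant
  1. The case of an indicator \<open>g\<close> gives ball averages, that of the profile of
  \<open>psi\<close> the reproducing formula.\<close>

lemma integral_radial_mean:
  fixes g :: "real \<Rightarrow> real"
  assumes [measurable]: "g \<in> borel_measurable borel" "h \<in> borel_measurable borel"
    and "integrable lborel (\<lambda>q. g (N q) * h q)" "integrable lborel (\<lambda>q. g (N q))"
    and mean: "AE r in lborel. r > 0 \<longrightarrow> (\<integral>v. h (\<delta> r v) \<partial>\<sigma>) = c * measure \<sigma> (space \<sigma>)"
  shows "(\<integral>q. g (N q) * h q \<partial>lborel) = c * (\<integral>q. g (N q) \<partial>lborel)"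
proof -
  note sigma_integral_measurable[OF assms(2), measurable]
  have "(\<integral>q. g (N q) * h q \<partial>lborel)
      = set_lebesgue_integral lborel {0<..} (\<lambda>r. g r * (r ^ m * (\<integral>v. h (\<delta> r v) \<partial>\<sigma>)))"
    by (rule integral_polar) fact
  also have "\<dots> = set_lebesgue_integral lborel {0<..} (\<lambda>r. c * (g r * (r ^ m * measure \<sigma> (space \<sigma>))))"
    unfolding set_lebesgue_integral_def
    by (rule integral_cong_AE, measurable) (use mean in eventually_elim, auto simp: indicator_def)
  also have "\<dots> = c * set_lebesgue_integral lborel {0<..} (\<lambda>r. g r * (r ^ m * (\<integral>v. 1 \<partial>\<sigma>)))"
    by simp
  also have "\<dots> = c * (\<integral>q. g (N q) * 1 \<partial>lborel)"
    using integral_polar[of g "\<lambda>_. 1"] assms(4) by simp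
  finally show ?thesis
    by simp
qed

lemma integrable_N_le:
  fixes h :: "'a \<Rightarrow> real"
  assumes "continuous_on UNIV h"
  shows "integrable lborel (\<lambda>q. indicator {..R} (N q) * h q)"
proof -
  have "integrable lborel (\<lambda>q. indicator {q. N q \<le> R} q *\<^sub>R h q)"
    by (intro borel_integrable_compact compact_N_le continuous_on_subset[OF assms]) simp
  then show ?thesis
    by (simp add: indicator_def)
qed

lemma emeasure_N_le_finite: "emeasure lborel {q. N q \<le> R} < \<infinity>"
  using compact_N_le by (rule emeasure_compact_finite)

text \<open>In polar coordinates the indicator of the sphere is radial and supported at the single
  radius 1.\<close>

lemma emeasure_N_sphere: "emeasure lborel {q. N q = 1} = 0"
proof -
  have "emeasure lborel {q. N q = 1} \<le> emeasure lborel {q. N q \<le> 1}"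
    by (rule emeasure_mono) auto
  then have fin: "emeasure lborel {q. N q = 1} < \<infinity>"
    using emeasure_N_le_finite by (rule order_le_less_trans)
  have ind: "indicator {1} (N q) = indicator {q. N q = 1} q" for q
    by (simp add: indicator_def)
  have "integrable lborel (\<lambda>q. indicator {1} (N q) * (1::real))"
    unfolding ind using fin by simp
  from integral_polar[OF this] have "measure lborel {q. N q = 1}
      = set_lebesgue_integral lborel {0<..} (\<lambda>r. indicator {1} r * (r ^ m * (\<integral>v. 1 \<partial>\<sigma>)))"
    unfolding ind by simp
  also have "\<dots> = 0"
    unfolding set_lebesgue_integral_def
    by (rule integral_eq_zero_AE) (use AE_lborel_singleton[of 1] in eventually_elim, simp)
  finally show ?thesis
    using fin by (simp add: measure_def enn2real_eq_0_iff less_top[symmetric])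
qed

text \<open>The polar formula makes the weighted radial integral of the nonnegative slice measures
  \<open>?M r\<close> vanish, so almost every slice is null.\<close>

lemma AE_sphere_null:
  assumes [measurable]: "A \<in> sets borel" and null: "emeasure lborel A = 0"
  shows "AE r in lborel. r > 0 \<longrightarrow> (AE v in \<sigma>. \<delta> r v \<notin> A)"
proof -
  let ?M = "\<lambda>r. \<integral>v. (indicator A (\<delta> r v) :: real) \<partial>\<sigma>"
  have M[measurable]: "?M \<in> borel_measurable borel"
    by (rule sigma_integral_measurable) simp
  have int_ind: "integrable \<sigma> (\<lambda>v. indicator A (\<delta> r v) :: real)" for r
    by (rule sigma.integrable_const_bound[where B=1]) auto
  have M0: "?M r \<ge> 0" for r
    by (rule integral_nonneg_AE) simp
  have M1: "?M r \<le> measure \<sigma> (space \<sigma>)" for r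
    using integral_mono[OF int_ind, of "\<lambda>_. 1"] by (simp add: indicator_def)
  \<comment> \<open>A vanishing Bochner integral is informative only for an integrable function.
    Cutting at \<open>n\<close> bounds the integrand on a bounded interval; countably many
    \<open>n\<close> then cover all radii.\<close>
  have "AE r in lborel. r > 0 \<and> r \<le> real n \<longrightarrow> ?M r = 0" for n
  proof -
    let ?f = "\<lambda>r. indicator {0<..} r * (indicator {..real n} r * (r ^ m * ?M r))"
    have AE0: "AE q in lborel. q \<notin> A"
      using null by (intro AE_not_in null_setsI) auto
    have "integrable lborel (\<lambda>q. indicator {..real n} (N q) * indicator A q :: real)"
      by (rule integrable_cong_AE_imp[of _ "\<lambda>_. 0"], simp, measurable) (use AE0 in eventually_elim, simp)
    from integral_polar[OF this] have "(\<integral>r. ?f r \<partial>lborel)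
        = (\<integral>q. indicator {..real n} (N q) * indicator A q \<partial>lborel)"
      by (simp add: set_lebesgue_integral_def)
    also have "\<dots> = 0"
      by (rule integral_eq_zero_AE) (use AE0 in eventually_elim, simp)
    finally have f0: "(\<integral>r. ?f r \<partial>lborel) = 0" .
    have "integrable lborel ?f"
    proof (rule Bochner_Integration.integrable_bound)
      show "integrable lborel (\<lambda>r. indicator {0..real n} r * (real n ^ m * measure \<sigma> (space \<sigma>)))"
        by simp
      have "norm (?f r) \<le> indicator {0..real n} r * (real n ^ m * measure \<sigma> (space \<sigma>))" for r
        using M0[of r] M1[of r] by (auto simp: indicator_def abs_mult intro!: mult_mono power_mono)
      then show "AE r in lborel. norm (?f r) \<le> norm (indicator {0..real n} r * (real n ^ m * measure \<sigma> (space \<sigma>)))"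
        by (intro AE_I2) (auto simp: abs_mult)
    qed simp
    moreover have "AE r in lborel. 0 \<le> ?f r"
      using M0 by (auto simp: indicator_def)
    ultimately have "AE r in lborel. ?f r = 0"
      using f0 by (simp add: integral_nonneg_eq_0_iff_AE)
    then show ?thesis
      by eventually_elim (auto simp: indicator_def)
  qed
  then have "AE r in lborel. \<forall>n. r > 0 \<and> r \<le> real n \<longrightarrow> ?M r = 0"
    unfolding AE_all_countable by blast
  then show ?thesis
  proof eventually_elim
    case (elim r)
    show ?case
    proof
      assume "r > 0"
      with elim have "?M r = 0"
        using real_arch_simple by blast
      then have "AE v in \<sigma>. indicator A (\<delta> r v) = (0::real)"
        using int_ind[of r] by (subst (asm) integral_nonneg_eq_0_iff_AE) auto
      then show "AE v in \<sigma>. \<delta> r v \<notin> A"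
        by eventually_elim (auto simp: indicator_def split: if_splits)
    qed
  qed
qed

end

section \<open>Mean value properties\<close>

lemma locally_integrable_compact:
  "locally_integrable u \<Longrightarrow> compact K \<Longrightarrow> integrable lebesgue (\<lambda>q. indicator K q * u q)"
  by (simp add: locally_integrable_def set_integrable_def)

context carnot_polar
begin

definition ball_mean_property :: "('a \<Rightarrow> real) \<Rightarrow> bool" where
  "ball_mean_property u \<longleftrightarrow> (\<forall>p. \<forall>R>0. u p = set_lebesgue_integral lebesgue (nball p R) u
     / measure lebesgue (nball p R))"

text \<open>The integrability clause guards against the default value 0 of the integral:
  \<open>u\<close> need not be integrable on an individual sphere.\<close>

definition sphere_mean_property :: "('a \<Rightarrow> real) \<Rightarrow> bool" where
  "sphere_mean_property u \<longleftrightarrow> (\<forall>p. \<forall>r>0. integrable \<sigma> (\<lambda>v. u (mul p (\<delta> r v))) \<and>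
     u p * measure \<sigma> (space \<sigma>) = integral\<^sup>L \<sigma> (\<lambda>v. u (mul p (\<delta> r v))))"

lemma ball_integral:
  fixes u :: "'a \<Rightarrow> real"
  assumes [measurable]: "u \<in> borel_measurable borel" and R: "R > 0"
  shows "(\<integral>q. indicator (nball p R) q * u q \<partial>lborel)
    = (\<integral>q. indicator {..R} (N q) * u (mul p q) \<partial>lborel)"
proof -
  have "indicator {..R} (N q) * u (mul p q) = (\<lambda>q. indicator (nball p R) q * u q) (mul p q)" for q
    using R by (simp add: nball_eq indicator_def)
  moreover have [measurable]: "nball p R \<in> sets borel"
    using compact_nball[OF R] by (simp add: borel_compact)
  ultimately show ?thesis
    by (simp only:) (intro integral_mul_left[symmetric], measurable)
qed

lemma integral_indicator_N_le:
  assumes "R > 0"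
  shows "(\<integral>q. indicator {..R} (N q) \<partial>lborel) = measure lebesgue (nball p R)"
proof -
  have "(\<lambda>q. indicator {..R} (N q) :: real) = indicator {q. N q \<le> R}"
    by (auto simp: indicator_def fun_eq_iff)
  then show ?thesis
    using measure_nball(1)[OF assms] by simp
qed

text \<open>The Borel representative \<open>w\<close> has the same spherical means about
  \<open>p\<close> as \<open>u\<close> for almost every radius. This is enough for the radial lemma
  with the indicator of \<open>{..R}\<close>; a translation then recovers the ball about
  \<open>p\<close>.\<close>

lemma sphere_mean_imp_ball_mean:
  assumes u: "locally_integrable u" and mean: "sphere_mean_property u"
  shows "ball_mean_property u"
  unfolding ball_mean_property_def
proof (intro allI impI)
  fix p and R :: real
  assume R: "R > 0"
  have um: "u \<in> borel_measurable lebesgue"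
    using u by (simp add: locally_integrable_def)
  obtain w where w[measurable]: "w \<in> borel_measurable borel" and uw: "AE q in lborel. u q = w q"
    using completion_ex_borel_measurable_real[OF um] by auto
  obtain Z where Z: "{q. u q \<noteq> w q} \<subseteq> Z" "emeasure lborel Z = 0" "Z \<in> sets borel"
    using AE_E[OF uw] by auto
  have nb[measurable]: "nball p R \<in> sets borel"
    using compact_nball[OF R] by (simp add: borel_compact)
  \<comment> \<open>The exceptional set is translated back by \<open>p\<close>, so that spheres
    about \<open>p\<close> become spheres about the origin; left invariance keeps it null.\<close>
  have "emeasure lborel {q. mul p q \<in> Z} = 0"
    using emeasure_mul_left[OF Z(3)] Z(2) by simp
  moreover have "{q. mul p q \<in> Z} \<in> sets borel"
    using measurable_sets[OF mul_measurable Z(3)] by (simp add: vimage_def)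
  ultimately have "AE r in lborel. r > 0 \<longrightarrow> (AE v in \<sigma>. \<delta> r v \<notin> {q. mul p q \<in> Z})"
    by (intro AE_sphere_null)
  then have sph: "AE r in lborel. r > 0 \<longrightarrow> (\<integral>v. w (mul p (\<delta> r v)) \<partial>\<sigma>) = u p * measure \<sigma> (space \<sigma>)"
  proof eventually_elim
    case (elim r)
    show ?case
    proof
      assume r: "r > 0"
      with elim have "AE v in \<sigma>. \<delta> r v \<notin> {q. mul p q \<in> Z}"
        by blast
      then have "AE v in \<sigma>. w (mul p (\<delta> r v)) = u (mul p (\<delta> r v))"
        by eventually_elim (use Z(1) in \<open>metis (mono_tags, lifting) mem_Collect_eq subsetD\<close>)
      moreover have "integrable \<sigma> (\<lambda>v. u (mul p (\<delta> r v)))"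
        using mean r by (simp add: sphere_mean_property_def)
      ultimately have "(\<integral>v. w (mul p (\<delta> r v)) \<partial>\<sigma>) = (\<integral>v. u (mul p (\<delta> r v)) \<partial>\<sigma>)"
        by (intro integral_cong_AE) auto
      then show "(\<integral>v. w (mul p (\<delta> r v)) \<partial>\<sigma>) = u p * measure \<sigma> (space \<sigma>)"
        using mean r by (simp add: sphere_mean_property_def)
    qed
  qed
  have aew: "AE q in lebesgue. indicator (nball p R) q * u q = indicator (nball p R) q * w q"
    using AE_completion[OF uw] by eventually_elim simp
  have "integrable lebesgue (\<lambda>q. indicator (nball p R) q * w q)"
    by (rule integrable_cong_AE_imp[OF locally_integrable_compact[OF u compact_nball[OF R, of p]] _ aew])
      (auto intro!: measurable_completion)
  then have int: "integrable lborel (\<lambda>q. indicator (nball p R) q * w q)"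
    by (subst (asm) integrable_completion) auto
  have ind: "indicator {..R} (N q) * w (mul p q) = (\<lambda>q. indicator (nball p R) q * w q) (mul p q)" for q
    using R by (simp add: nball_eq indicator_def)
  have "integrable lborel (\<lambda>q. indicator {..R} (N q) * w (mul p q))"
    unfolding ind by (subst integrable_mul_left) (use int in auto)
  moreover have "integrable lborel (\<lambda>q. indicator {..R} (N q) :: real)"
    using integrable_N_le[of "\<lambda>_. 1" R] by simp
  ultimately have "(\<integral>q. indicator {..R} (N q) * w (mul p q) \<partial>lborel)
      = u p * (\<integral>q. indicator {..R} (N q) \<partial>lborel)"
    by (intro integral_radial_mean sph) auto
  also have "(\<integral>q. indicator {..R} (N q) \<partial>lborel) = measure lebesgue (nball p R)"
    by (rule integral_indicator_N_le[OF R])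
  finally have "(\<integral>q. indicator (nball p R) q * w q \<partial>lborel) = u p * measure lebesgue (nball p R)"
    using ball_integral[OF w R] by simp
  moreover have "set_lebesgue_integral lebesgue (nball p R) u = (\<integral>q. indicator (nball p R) q * w q \<partial>lebesgue)"
    unfolding set_lebesgue_integral_def real_scaleR_def
    by (rule integral_cong_AE[OF _ _ aew])
      (use locally_integrable_compact[OF u compact_nball[OF R, of p]] in \<open>auto intro!: measurable_completion\<close>)
  moreover have "\<dots> = (\<integral>q. indicator (nball p R) q * w q \<partial>lborel)"
    by (rule integral_completion) measurable
  ultimately show "u p = set_lebesgue_integral lebesgue (nball p R) u / measure lebesgue (nball p R)"
    using measure_nball(1)[OF R, of p] measure_nball(2)[OF R] by simp
qed

text \<open>All unit balls have the same measure, so \<open>u\<close> is a multiple of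
  \<open>G\<close>. As centres converge to \<open>p\<close>, the indicators converge off the sphere
  of radius 1 about \<open>p\<close>, a null set, and dominated convergence applies.\<close>

lemma ball_mean_imp_continuous:
  assumes u: "locally_integrable u" and mean: "ball_mean_property u"
  shows "continuous_on UNIV u"
proof -
  define G where "G p = (\<integral>q. indicator (nball p 1) q * u q \<partial>lebesgue)" for p
  have "continuous_on UNIV G"
    unfolding continuous_on_sequentially
  proof (intro allI ballI impI)
    fix x :: "nat \<Rightarrow> 'a" and p
    assume "(\<forall>n. x n \<in> UNIV) \<and> x \<longlonglongrightarrow> p"
    then have x: "x \<longlonglongrightarrow> p"
      by blast
    then obtain B where B: "\<And>n. norm (x n) \<le> B"
      using convergent_imp_Bseq[OF convergentI[OF x]] by (auto simp: Bseq_def)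
    \<comment> \<open>A single compact set containing every unit ball about \<open>x n\<close>,
      which yields the integrable bound \<open>\<bar>indicator K q * u q\<bar>\<close>.\<close>
    define K where "K = (\<lambda>z. mul (fst z) (snd z)) ` (cball 0 B \<times> {q. N q \<le> 1})"
    have K: "compact K"
      unfolding K_def by (intro compact_mul_N_le compact_cball)
    have sub: "nball (x n) 1 \<subseteq> K" for n
      unfolding K_def using B by (auto simp: nball_eq intro!: mem_mul_N_le)
    have "(\<lambda>n. G (x n)) \<longlonglongrightarrow> G p"
      unfolding G_def
    proof (rule integral_dominated_convergence)
      show "integrable lebesgue (\<lambda>q. \<bar>indicator K q * u q\<bar>)"
        using locally_integrable_compact[OF u K] by (rule integrable_abs)
      show "(\<lambda>q. indicator (nball p 1) q * u q) \<in> borel_measurable lebesgue"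
        "(\<lambda>q. indicator (nball (x n) 1) q * u q) \<in> borel_measurable lebesgue" for n
        using locally_integrable_compact[OF u compact_nball] by auto
      show "AE q in lebesgue. norm (indicator (nball (x n) 1) q * u q) \<le> \<bar>indicator K q * u q\<bar>" for n
        using sub[of n] by (auto simp: indicator_def)
      have "emeasure lborel {q. mul (- p) q \<in> {q. N q = 1}} = 0"
        by (subst emeasure_mul_left) (auto simp: emeasure_N_sphere)
      then have "AE q in lborel. q \<notin> {q. mul (- p) q \<in> {q. N q = 1}}"
        by (intro AE_not_in null_setsI) auto
      then have "AE q in lebesgue. N (mul (- p) q) \<noteq> 1"
        by (intro AE_completion) simp
      then show "AE q in lebesgue. (\<lambda>n. indicator (nball (x n) 1) q * u q)
          \<longlonglongrightarrow> indicator (nball p 1) q * u q"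
      proof eventually_elim
        case (elim q)
        have "continuous_on UNIV (\<lambda>p. N (mul (- p) q))"
          by (intro continuous_intros)
        then have lim: "(\<lambda>n. N (mul (- x n) q)) \<longlonglongrightarrow> N (mul (- p) q)"
          using x by (auto simp: continuous_on_sequentially o_def)
        have "\<forall>\<^sub>F n in sequentially. (N (mul (- x n) q) \<le> 1) = (N (mul (- p) q) \<le> 1)"
        proof (cases "N (mul (- p) q) < 1")
          case True
          from order_tendstoD(2)[OF lim True] show ?thesis
            by eventually_elim (use True in auto)
        next
          case False
          with elim have "N (mul (- p) q) > 1"
            by simp
          from order_tendstoD(1)[OF lim this] show ?thesis
            by eventually_elim (use False elim in auto)
        qed
        then have "\<forall>\<^sub>F n in sequentially. indicator (nball (x n) 1) q * u q = indicator (nball p 1) q * u q"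
          by eventually_elim (simp add: nball_eq indicator_def)
        then show ?case
          by (rule tendsto_eventually)
      qed
    qed
    then show "(G \<circ> x) \<longlonglongrightarrow> G p"
      by (simp add: o_def)
  qed
  moreover have "u p = G p / measure lborel {q. N q \<le> 1}" for p
  proof -
    have "u p = set_lebesgue_integral lebesgue (nball p 1) u / measure lebesgue (nball p 1)"
      using mean by (simp add: ball_mean_property_def)
    then show ?thesis
      by (simp add: G_def set_lebesgue_integral_def measure_nball)
  qed
  then have "u = (\<lambda>p. G p / measure lborel {q. N q \<le> 1})"
    by (rule ext)
  ultimately show ?thesis
    using measure_nball(2)[of 1] by (auto intro: continuous_on_divide)
qed

lemma compact_space_sigma: "compact (space \<sigma>)"
proof -
  have "closed {q. N q = 1}"
    by (intro closed_Collect_eq continuous_intros)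
  then have "compact ({q. N q \<le> 1} \<inter> {q. N q = 1})"
    by (intro compact_Int_closed compact_N_le)
  also have "{q. N q \<le> 1} \<inter> {q. N q = 1} = space \<sigma>"
    by (auto simp: space_sigma N_sphere_def)
  finally show ?thesis .
qed

text \<open>Over bounded \<open>r\<close> the integrand is bounded by compactness of the unit
  sphere, and \<open>\<sigma>\<close> is finite, so a constant dominates. Negative \<open>r\<close>
  are harmless since \<open>\<delta>\<close> is polynomial in \<open>r\<close>.\<close>

lemma sphere_average_continuous:
  fixes h :: "'a \<Rightarrow> real"
  assumes h: "continuous_on UNIV h"
  shows "integrable \<sigma> (\<lambda>v. h (\<delta> r v))" and "continuous_on UNIV (\<lambda>r. \<integral>v. h (\<delta> r v) \<partial>\<sigma>)"
proof -
  have [measurable]: "h \<in> borel_measurable borel"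
    using h by (rule borel_measurable_continuous_onI)
  have hd: "continuous_on A (\<lambda>z. h (\<delta> (fst z) (snd z)))" for A
    by (rule continuous_on_compose2[OF h continuous_dil_pair]) simp
  have bnd: "\<exists>C. \<forall>r v. \<bar>r\<bar> \<le> B \<longrightarrow> v \<in> space \<sigma> \<longrightarrow> norm (h (\<delta> r v)) \<le> C" for B :: real
  proof -
    have "bounded ((\<lambda>z. h (\<delta> (fst z) (snd z))) ` ({- B..B} \<times> space \<sigma>))"
      by (intro compact_imp_bounded compact_continuous_image hd compact_Times compact_Icc compact_space_sigma)
    then obtain C where "\<forall>z\<in>{- B..B} \<times> space \<sigma>. norm (h (\<delta> (fst z) (snd z))) \<le> C"
      by (auto simp: bounded_iff)
    then show ?thesis
      by (intro exI[of _ C]) (auto simp: abs_le_iff)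
  qed
  obtain C where C: "v \<in> space \<sigma> \<Longrightarrow> norm (h (\<delta> r v)) \<le> C" for v
    using bnd[of "\<bar>r\<bar>"] by auto
  show "integrable \<sigma> (\<lambda>v. h (\<delta> r v))"
    by (rule sigma.integrable_const_bound[where B=C]) (use C in auto)
  show "continuous_on UNIV (\<lambda>r. \<integral>v. h (\<delta> r v) \<partial>\<sigma>)"
    unfolding continuous_on_sequentially
  proof (intro allI ballI impI)
    fix x :: "nat \<Rightarrow> real" and r
    assume "(\<forall>n. x n \<in> UNIV) \<and> x \<longlonglongrightarrow> r"
    then have x: "x \<longlonglongrightarrow> r"
      by blast
    then obtain B where B: "\<And>n. norm (x n) \<le> B"
      using convergent_imp_Bseq[OF convergentI[OF x]] by (auto simp: Bseq_def)
    obtain C where C: "\<bar>r\<bar> \<le> B \<Longrightarrow> v \<in> space \<sigma> \<Longrightarrow> norm (h (\<delta> r v)) \<le> C" for r v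
      using bnd[of B] by auto
    have "(\<lambda>n. \<integral>v. h (\<delta> (x n) v) \<partial>\<sigma>) \<longlonglongrightarrow> (\<integral>v. h (\<delta> r v) \<partial>\<sigma>)"
    proof (rule integral_dominated_convergence)
      show "integrable \<sigma> (\<lambda>v. C)"
        by simp
      show "AE v in \<sigma>. (\<lambda>n. h (\<delta> (x n) v)) \<longlonglongrightarrow> h (\<delta> r v)"
      proof (intro AE_I2)
        fix v
        have "continuous_on UNIV (\<lambda>r. h (\<delta> r v))"
          by (rule continuous_on_compose2[OF h]) (auto intro!: continuous_intros)
        then show "(\<lambda>n. h (\<delta> (x n) v)) \<longlonglongrightarrow> h (\<delta> r v)"
          using x by (auto simp: continuous_on_sequentially o_def)
      qed
    qed (use B C in auto)
    then show "((\<lambda>r. \<integral>v. h (\<delta> r v) \<partial>\<sigma>) \<circ> x) \<longlonglongrightarrow> (\<integral>v. h (\<delta> r v) \<partial>\<sigma>)"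
      by (simp add: o_def)
  qed
qed

lemma continuous_ball_mean_imp_sphere_mean:
  assumes u: "continuous_on UNIV u" and mean: "ball_mean_property u"
  shows "sphere_mean_property u"
  unfolding sphere_mean_property_def
proof (intro allI impI conjI)
  fix p and r :: real
  assume r: "r > 0"
  have um[measurable]: "u \<in> borel_measurable borel"
    using u by (rule borel_measurable_continuous_onI)
  have h: "continuous_on UNIV (\<lambda>q. u (mul p q))"
    by (rule continuous_on_compose2[OF u]) (auto intro!: continuous_intros)
  show "integrable \<sigma> (\<lambda>v. u (mul p (\<delta> r v)))"
    by (rule sphere_average_continuous(1)[OF h])
  \<comment> \<open>Subtracting \<open>u p\<close> inside the spherical integral turns the ball
    property into the vanishing of all prefix integrals of one continuous function; the weight
    \<open>r ^ m\<close> is cancelled at the end since \<open>r > 0\<close>.\<close>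
  define W where "W r = r ^ m * (\<integral>v. u (mul p (\<delta> r v)) - u p \<partial>\<sigma>)" for r
  have Wc: "continuous_on UNIV W"
    unfolding W_def by (intro continuous_intros sphere_average_continuous(2) h)
  have "integral {0..R} W = 0" if R: "R > 0" for R
  proof -
    let ?I = "\<lambda>q. indicator {..R} (N q) :: real"
    have [measurable]: "nball p R \<in> sets borel"
      using compact_nball[OF R] by (simp add: borel_compact)
    have "u p * measure lebesgue (nball p R) = set_lebesgue_integral lebesgue (nball p R) u"
      using mean R measure_nball(1)[OF R, of p] measure_nball(2)[OF R] unfolding ball_mean_property_def
      by (metis less_irrefl nonzero_eq_divide_eq)
    also have "\<dots> = (\<integral>q. indicator (nball p R) q * u q \<partial>lborel)"
      unfolding set_lebesgue_integral_def real_scaleR_def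
      by (rule integral_completion) measurable
    also have "\<dots> = (\<integral>q. ?I q * u (mul p q) \<partial>lborel)"
      by (rule ball_integral[OF um R])
    finally have "(\<integral>q. ?I q * u (mul p q) \<partial>lborel) - (\<integral>q. ?I q * u p \<partial>lborel) = 0"
      using integral_indicator_N_le[OF R] by (simp add: mult.commute)
    then have "(\<integral>q. ?I q * (u (mul p q) - u p) \<partial>lborel) = 0"
      using integrable_N_le[OF h] integrable_N_le[of "\<lambda>_. u p" R]
      by (simp add: right_diff_distrib)
    moreover have "integrable lborel (\<lambda>q. ?I q * (u (mul p q) - u p))"
      by (intro integrable_N_le continuous_intros h)
    from integral_polar[OF this] have "(\<integral>q. ?I q * (u (mul p q) - u p) \<partial>lborel)
        = set_lebesgue_integral lborel {0<..} (\<lambda>r. indicator {..R} r * W r)"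
      by (simp add: W_def)
    ultimately show ?thesis
      using set_integral_Ioc_eq_integral_Icc[OF Wc] by simp
  qed
  then have "W r = 0"
    using integral_continuous_prefix_zero[OF Wc] r by blast
  then have "(\<integral>v. u (mul p (\<delta> r v)) - u p \<partial>\<sigma>) = 0"
    using r by (simp add: W_def)
  then show "u p * measure \<sigma> (space \<sigma>) = (\<integral>v. u (mul p (\<delta> r v)) \<partial>\<sigma>)"
    using sphere_average_continuous(1)[OF h, of r] by (simp add: mult.commute)
qed

section \<open>The radial kernel and smoothness\<close>

lemma psi_radial:
  obtains g where "psi N k = (\<lambda>q. g (N q))" "g \<in> borel_measurable borel" "\<And>r. r \<ge> 1 \<Longrightarrow> g r = 0"
proof
  define C where "C = 1 / integral\<^sup>L lebesgue (\<lambda>q. indicator {q. N q < 1} q * exp (- 1 / (1 - N q ^ k)))"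
  let ?g = "\<lambda>r::real. if r < 1 then C * exp (- 1 / (1 - r ^ k)) else 0"
  show "psi N k = (\<lambda>q. ?g (N q))"
    by (simp add: psi_def C_def Let_def fun_eq_iff)
  show "?g \<in> borel_measurable borel"
    by measurable
qed simp

text \<open>Normalisation by \<open>C\<close> works only if the integral in its denominator is a
  genuine nonzero number: the integrand is bounded on a set of finite measure and positive on the
  open unit ball, which is not null.\<close>

lemma integral_psi:
  assumes "k \<ge> 1"
  shows "(\<integral>q. psi N k q \<partial>lborel) = 1"
proof -
  let ?e = "\<lambda>q. indicator {q. N q < 1} q * exp (- 1 / (1 - N q ^ k)) :: real"
  have e[measurable]: "?e \<in> borel_measurable borel"
    by measurable
  have "integrable lborel ?e"
  proof (rule Bochner_Integration.integrable_bound)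
    show "integrable lborel (indicator {q. N q \<le> 1} :: 'a \<Rightarrow> real)"
      using emeasure_N_le_finite by simp
    \<comment> \<open>From \<open>N q ^ k \<le> 1\<close> the exponent is nonpositive, so the
      exponential is at most 1.\<close>
    have "norm (?e q) \<le> norm (indicator {q. N q \<le> 1} q :: real)" for q
      using N_nonneg[of q] assms power_le_one[of "N q" k] by (auto simp: indicator_def)
    then show "AE q in lborel. norm (?e q) \<le> norm (indicator {q. N q \<le> 1} q :: real)"
      by simp
  qed simp
  moreover have "(\<integral>q. ?e q \<partial>lborel) \<noteq> 0"
  proof
    assume "(\<integral>q. ?e q \<partial>lborel) = 0"
    then have "AE q in lborel. ?e q = 0"
      using \<open>integrable lborel ?e\<close> by (subst (asm) integral_nonneg_eq_0_iff_AE) auto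
    then have "AE q in lborel. q \<notin> {q. N q < 1}"
      by eventually_elim (auto simp: indicator_def split: if_splits)
    then have "emeasure lborel {q. N q < 1} = 0"
      by (subst (asm) AE_iff_null) (auto simp: null_sets_def)
    then show False
      using emeasure_N_less_nonzero[of 1] by simp
  qed
  moreover have "psi N k = (\<lambda>q. ?e q / (\<integral>q. ?e q \<partial>lebesgue))"
    by (auto simp: psi_def Let_def fun_eq_iff indicator_def)
  moreover have "(\<integral>q. ?e q \<partial>lebesgue) = (\<integral>q. ?e q \<partial>lborel)"
    by (rule integral_completion) measurable
  ultimately show ?thesis
    by simp
qed

text \<open>The radial lemma with the profile of \<open>psi\<close> gives \<open>u p\<close> as an
  integral of \<open>u (mul p q)\<close>. Left invariance then moves \<open>p\<close> from
  \<open>u\<close> into the kernel, the only place where dependence on \<open>p\<close> can be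
  differentiated.\<close>

lemma sphere_mean_reproducing:
  assumes k: "k \<ge> 1" and psi: "continuous_on UNIV (psi N k)" and u: "continuous_on UNIV u"
    and mean: "sphere_mean_property u"
  shows "u p = integral UNIV (\<lambda>q. u q * psi N k (mul (- p) q))"
proof -
  obtain g where g: "psi N k = (\<lambda>q. g (N q))" "g \<in> borel_measurable borel" "\<And>r. r \<ge> 1 \<Longrightarrow> g r = 0"
    using psi_radial[of k] by metis
  have um[measurable]: "u \<in> borel_measurable borel" and pm[measurable]: "psi N k \<in> borel_measurable borel"
    using u psi by (simp_all add: borel_measurable_continuous_onI)
  have up: "continuous_on UNIV (\<lambda>q. u (mul p q))"
    by (rule continuous_on_compose2[OF u]) (auto intro!: continuous_intros)
  \<comment> \<open>The kernel vanishes outside the unit ball, so inserting its indicator changes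
    nothing and makes products with continuous functions integrable.\<close>
  have cut: "psi N k q * h q = indicator {..1} (N q) * (psi N k q * h q)" for q and h :: "'a \<Rightarrow> real"
    using g(3)[of "N q"] by (cases "N q \<le> 1") (simp_all add: g(1))
  have int: "integrable lborel (\<lambda>q. psi N k q * h q)" if "continuous_on UNIV h" for h :: "'a \<Rightarrow> real"
    by (subst cut) (intro integrable_N_le continuous_intros psi that)
  have "(\<integral>q. g (N q) * u (mul p q) \<partial>lborel) = u p * (\<integral>q. g (N q) \<partial>lborel)"
  proof (rule integral_radial_mean)
    show "integrable lborel (\<lambda>q. g (N q) * u (mul p q))"
      using int[OF up] by (simp add: g(1))
    show "integrable lborel (\<lambda>q. g (N q))"
      using int[of "\<lambda>_. 1"] by (simp add: g(1))
    show "AE r in lborel. r > 0 \<longrightarrow> (\<integral>v. u (mul p (\<delta> r v)) \<partial>\<sigma>) = u p * measure \<sigma> (space \<sigma>)"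
      using mean by (simp add: sphere_mean_property_def)
  qed (use g(2) in measurable)
  then have "u p = (\<integral>q. psi N k q * u (mul p q) \<partial>lborel)"
    using integral_psi[OF k] by (simp add: g(1))
  also have "\<dots> = (\<integral>q. u q * psi N k (mul (- p) q) \<partial>lborel)"
    using integral_mul_left[of "\<lambda>q. u q * psi N k (mul (- p) q)" p] by (simp add: mult.commute)
  also have "\<dots> = integral UNIV (\<lambda>q. u q * psi N k (mul (- p) q))"
  proof (rule integral_lborel[symmetric])
    show "integrable lborel (\<lambda>q. u q * psi N k (mul (- p) q))"
      using integrable_mul_left[of "\<lambda>q. u q * psi N k (mul (- p) q)" p] int[OF up]
      by (simp add: mult.commute)
  qed
  finally show ?thesis .
qed

text \<open>Group inversion is the linear map \<open>p \<mapsto> - p\<close>, so the kernel is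
  jointly smooth; for \<open>p\<close> in a bounded ball its supports in \<open>q\<close> stay in
  one compact set.\<close>

lemma sphere_mean_imp_smooth:
  assumes k: "k \<ge> 1" and psi: "smooth (psi N k)" and u: "continuous_on UNIV u"
    and mean: "sphere_mean_property u"
  shows "smooth u"
proof -
  let ?h = "\<lambda>z. psi N k (mul (- fst z) (snd z))"
  obtain g where g: "psi N k = (\<lambda>q. g (N q))" "\<And>r. r \<ge> 1 \<Longrightarrow> g r = 0"
    using psi_radial[of k] by metis
  have "smooth (\<lambda>z::'a \<times> 'a. (- fst z, snd z))"
    by (intro smooth_bounded_linear bounded_linear_Pair bounded_linear_minus
        bounded_linear_fst bounded_linear_snd)
  then have "smooth ?h"
    using smooth_compose[OF psi smooth_compose[OF smooth_mul, of "\<lambda>z. (- fst z, snd z)"]] by simp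
  moreover have "\<exists>a b. \<forall>p\<in>ball 0 M. \<forall>q. q \<notin> cbox a b \<longrightarrow> ?h (p, q) = 0" for M
  proof -
    let ?K = "(\<lambda>z. mul (fst z) (snd z)) ` (cball 0 M \<times> {q. N q \<le> 1})"
    have "bounded ?K"
      by (intro compact_imp_bounded compact_mul_N_le compact_cball)
    then obtain a where a: "?K \<subseteq> cbox (- a) a"
      using bounded_subset_cbox_symmetric by blast
    have "?h (p, q) = 0" if "p \<in> ball 0 M" "q \<notin> cbox (- a) a" for p q
    proof -
      have "\<not> N (mul (- p) q) \<le> 1"
        using mem_mul_N_le[of p "cball 0 M" q 1] a that by auto
      then show ?thesis
        using g by simp
    qed
    then show ?thesis
      by blast
  qed
  ultimately have "smooth (\<lambda>p. integral UNIV (\<lambda>q. u q * ?h (p, q)))"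
    by (rule smooth_parametric_integral[OF u])
  then show ?thesis
    using sphere_mean_reproducing[OF k smooth_imp_continuous[OF psi] u mean, symmetric] by simp
qed

end

theorem theorem4p5:
  fixes mul :: "'a::euclidean_space \<Rightarrow> 'a \<Rightarrow> 'a"
    and V :: "nat \<Rightarrow> 'a set" and s :: nat
    and N :: "'a \<Rightarrow> real" and \<sigma> :: "'a measure"
    and k :: nat and u :: "'a \<Rightarrow> real"
  assumes "carnot_group mul V s"
    and "hom_pseudonorm V s N"
    and "polar_measure V s N \<sigma>"
    and "k \<ge> 1"
    and "smooth_compact_support (psi N k)"
    and "locally_integrable u"
  shows "((\<forall>p. \<forall>R>0. u p = set_lebesgue_integral lebesgue (N_ball mul V s N p R) u
                             / measure lebesgue (N_ball mul V s N p R))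
          \<longleftrightarrow>
          (\<forall>p. \<forall>r>0. integrable \<sigma> (\<lambda>v. u (mul p (dil V s r v))) \<and>
                      u p * measure \<sigma> (space \<sigma>) = integral\<^sup>L \<sigma> (\<lambda>v. u (mul p (dil V s r v)))))
       \<and> ((\<forall>p. \<forall>R>0. u p = set_lebesgue_integral lebesgue (N_ball mul V s N p R) u
                             / measure lebesgue (N_ball mul V s N p R))
          \<longrightarrow> smooth u)"
proof -
  interpret carnot_polar mul V s N \<sigma>
    by unfold_locales fact+
  \<comment> \<open>Regularity is extracted from the ball property; a function with the spherical
    property inherits it through the equivalence.\<close>
  have "ball_mean_property u \<Longrightarrow> sphere_mean_property u"
    using ball_mean_imp_continuous continuous_ball_mean_imp_sphere_mean assms(6) by blast
  moreover have "ball_mean_property u \<Longrightarrow> smooth u"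
    using ball_mean_imp_continuous sphere_mean_imp_smooth calculation assms(4-6)
    by (auto simp: smooth_compact_support_def)
  ultimately show ?thesis
    using sphere_mean_imp_ball_mean[OF assms(6)]
    unfolding ball_mean_property_def sphere_mean_property_def by blast
qed

end
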